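(* For every integer $n\ge 0$, the following congruences hold: \begin{align*} c\phi_{9}(9n+3) &\equiv 0 \pmod{3^2}, & c\phi_{9}(9n+6) &\equiv 0 \pmod{3^3},\\ c\phi_{9}(27n+15) &\equiv 0 \pmod{3^5}, & c\phi_{9}(27n+24) &\equiv 0 \pmod{3^7},\\ c\phi_{9}(81n+51) &\equiv 0 \pmod{3^8}, & c\phi_{9}(81n+78) &\equiv 0 \pmod{3^9},\\ c\phi_{9}(243n+132) &\equiv 0 \pmod{3^{10}}, & c\phi_{9}(243n+213) &\equiv 0 \pmod{3^{12}},\\ c\phi_{9}(729n+456)&\equiv 0 \pmod{3^{13}}, & c\phi_{9}(729n+699)&\equiv 0 \pmod{3^{14}}. \end{align*}
   Context: For a positive integer $k$, color each nonnegative integer with each of $k$ colors $1,\dots,k$, writing $a_c$ for $a$ with color $c$, and order colored integers by $0_1\prec 0_2\prec\cdots\prec 0_k\prec 1_1\prec\cdots\prec 1_k\prec 2_1\prec\cdots$. A $k$-colored generalized Frobenius partition of $n$ is a two-row array $\begin{pmatrix} a_1,\dots,a_r\\ b_1,\dots,b_r\end{pmatrix}$ of colored integers with $a_r\prec a_{r-1}\prec\cdots\prec a_1$ and $b_r\prec\cdots\prec b_1$ and $n=r+\sum_{i=1}^r(a_i+b_i)$ (the sum using the underlying integers). $c\phi_k(n)$ denotes the number of $k$-colored generalized Frobenius partitions of $n$. Equivalently, $\sum_{n\ge0}c\phi_k(n)q^n=\frac{1}{(q;q)_\infty^k}\sum_{m_1,\dots,m_{k-1}\in\mathbb{Z}}q^{\sum_i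 m_i^2+\sum_{i<j}m_im_j}$, where $(q;q)_\infty=\prod_{n\ge1}(1-q^n)$. *)

theory Defs
  imports "HOL-Number_Theory.Cong"
begin

text \<open>
  The pair \<open>(a, c)\<close> encodes the colored integer $a_c$, the integer $a$ with color $c$.
\<close>

type_synonym colored_nat = "nat \<times> nat"

definition colored_nats :: "nat \<Rightarrow> colored_nat set" where
  "colored_nats k = {(a, c). 1 \<le> c \<and> c \<le> k}"

definition colored_less :: "colored_nat \<Rightarrow> colored_nat \<Rightarrow> bool" where
  "colored_less x y \<longleftrightarrow> fst x < fst y \<or> (fst x = fst y \<and> snd x < snd y)"

text \<open>
  A row is listed from left to right, hence is a strictly decreasing list.
\<close>

definition frobenius_row :: "nat \<Rightarrow> colored_nat list \<Rightarrow> bool" where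
  "frobenius_row k xs \<longleftrightarrow>
     set xs \<subseteq> colored_nats k \<and> sorted_wrt (\<lambda>x y. colored_less y x) xs"

definition gen_frobenius_partitions :: "nat \<Rightarrow> nat \<Rightarrow> (colored_nat list \<times> colored_nat list) set" where
  "gen_frobenius_partitions k n =
     {(as, bs). frobenius_row k as \<and> frobenius_row k bs \<and> length as = length bs \<and>
        n = length as + (\<Sum>i<length as. fst (as ! i) + fst (bs ! i))}"

definition cphi :: "nat \<Rightarrow> nat \<Rightarrow> nat" where
  "cphi k n = card (gen_frobenius_partitions k n)"

text \<open>
  The set being counted is finite, so the convention that infinite sets have cardinality zero
  plays no role in \<^const>\<open>cphi\<close>.
\<close>

lemma finite_gen_frobenius_partitions: "finite (gen_frobenius_partitions k n)"
proof -
  let ?L = "{xs. set xs \<subseteq> {..n} \<times> {..k} \<and> length xs \<le> n}"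
  have fin: "finite ?L"
    by (rule finite_lists_length_le) simp
  have "gen_frobenius_partitions k n \<subseteq> ?L \<times> ?L"
  proof
    fix p assume p: "p \<in> gen_frobenius_partitions k n"
    obtain as bs where [simp]: "p = (as, bs)" by (cases p)
    from p have row: "set as \<subseteq> colored_nats k" "set bs \<subseteq> colored_nats k"
      and len: "length as = length bs"
      and n: "n = length as + (\<Sum>i<length as. fst (as ! i) + fst (bs ! i))"
      by (auto simp: gen_frobenius_partitions_def frobenius_row_def)
    have bound: "fst (as ! i) + fst (bs ! i) \<le> n" if "i < length as" for i
      using member_le_sum[of i "{..<length as}" "\<lambda>i. fst (as ! i) + fst (bs ! i)"] that n
      by simp
    have "fst x \<le> n" if x: "x \<in> set as \<union> set bs" for x
    proof -
      from x obtain i where "i < length as" "x = as ! i \<or> x = bs ! i"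
        using len by (auto simp: in_set_conv_nth)
      with bound[of i] show ?thesis by auto
    qed
    then show "p \<in> ?L \<times> ?L"
      using row len n by (fastforce simp: colored_nats_def)
  qed
  then show ?thesis
    using fin by (meson finite_SigmaI finite_subset)
qed

end

theory Submission
  imports Defs "HOL-Computational_Algebra.Computational_Algebra" "HOL-Library.Product_Lexorder"
begin

text \<open>
  By the Jacobi triple product the generating function is \<open>f ^ 9\<close> times the theta series of the
  lattice A8, where \<open>f = 1 / (q; q)\<close> is the partition generating function. Sorting three rows of
  three coordinates by their sums modulo 3 writes that theta series in terms of the hexagonal theta
  series \<open>A\<close>, its translate \<open>C = 3 Y\<close>, and their dilations \<open>q \<mapsto> q ^ 3\<close>.

  Put \<open>\<tau> = q (Y / A) ^ 3\<close> and let \<open>w\<close> be the cube root of \<open>\<tau> (q ^ 3)\<close>. The classical dissection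
  of \<open>A\<close> and the cubic theta function identity give \<open>A = A (q ^ 3) (1 + 6 w)\<close> and
  \<open>\<tau> (1 + 6 w) ^ 3 = w (1 + 3 w + 9 w ^ 2)\<close>, and \<open>f ^ 3\<close> equals \<open>f (q ^ 3)\<close> divided by
  \<open>A (q ^ 3) (1 - 3 w)\<close>. Hence repeated trisection leads alternately to series
  \<open>A f ^ 3 S (\<tau>)\<close> and \<open>A f (q ^ 3) ^ 3 S (\<tau>)\<close>, and acts linearly on \<open>S\<close>. Since \<open>w\<close> occurs
  essentially through \<open>3 w\<close>, all \<open>S\<close> are short polynomials modulo \<open>3 ^ 14\<close>, whose coefficients
  gain powers of 3 at each trisection.
\<close>

subsection \<open>Congruences in commutative rings\<close>

text \<open>The denominators \<open>1 - 3 w\<close> and \<open>1 + 6 w\<close> make an exact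
  trisection step an infinite series in \<open>3 w\<close>. Modulo \<open>3 ^ 14\<close>, the
  largest modulus claimed, it becomes a polynomial, and each certificate is an exact identity whose
  right-hand side is \<open>3 ^ 14\<close> times a polynomial. Class 0 of a trisection is again a
  polynomial in \<open>\<tau>\<close> times the expected prefactor. Class 2 produces
  \<open>f v ^ 2\<close> with \<open>v = Y / A\<close>, which is outside that form until it is
  multiplied by \<open>q\<close>: then \<open>q f v ^ 2 = A f (q ^ 3) ^ 3 \<tau>\<close>. Hence the
  chain alternates between class 0 and \<open>q\<close> times class 2, and the indices of its later
  members are shifted by one. The classes not followed further supply the remaining congruences. The
  large coefficients in a step are representatives modulo \<open>3 ^ 14\<close> of the class
  selected in the step before.\<close>

definition congr :: "'a::comm_ring_1 \<Rightarrow> 'a \<Rightarrow> 'a \<Rightarrow> bool" where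
  "congr d a b \<longleftrightarrow> d dvd a - b"

lemma congr_refl [simp]: "congr d a a"
  by (simp add: congr_def)

lemma congr_sym: "congr d a b \<Longrightarrow> congr d b a"
  unfolding congr_def by (metis dvd_minus_iff minus_diff_eq)

lemma congr_trans [trans]: "congr d a b \<Longrightarrow> congr d b c \<Longrightarrow> congr d a c"
  unfolding congr_def by (metis diff_add_cancel dvd_add add_diff_eq)

lemma congr_add: "congr d a b \<Longrightarrow> congr d a' b' \<Longrightarrow> congr d (a + a') (b
    + b')"
  unfolding congr_def by (metis add_diff_add dvd_add)

lemma congr_mult: "congr d a b \<Longrightarrow> congr d a' b' \<Longrightarrow> congr d (a * a')
    (b * b')"
proof -
  assume "congr d a b" "congr d a' b'"
  moreover have "a * a' - b * b' = (a - b) * a' + b * (a' - b')"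
    by (simp add: algebra_simps)
  ultimately show ?thesis
    unfolding congr_def by (simp add: dvd_add)
qed

lemma congr_mult_left: "congr d a b \<Longrightarrow> congr d (c * a) (c * b)"
  by (simp add: congr_mult)

lemma congr_power: "congr d a b \<Longrightarrow> congr d (a ^ n) (b ^ n)"
  by (induction n) (auto intro: congr_mult)

lemma congr_sum: "(\<And>i. i \<in> I \<Longrightarrow> congr d (g i) (h i)) \<Longrightarrow> congr
    d (sum g I) (sum h I)"
  by (induction I rule: infinite_finite_induct) (auto intro: congr_add)

lemma congr_unit_cancel:
  assumes "u * v = 1" "congr d (u * a) (u * b)"
  shows "congr d a b"
proof -
  have "congr d (v * (u * a)) (v * (u * b))"
    using assms(2) by (rule congr_mult_left)
  moreover have "v * (u * x) = x" for x
    using assms(1) by (metis mult.assoc mult.commute mult_1)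
  ultimately show ?thesis by simp
qed

lemma fps_congr_X_iff:
  fixes F G :: "'a::comm_ring_1 fps"
  shows "congr (fps_X ^ N) F G \<longleftrightarrow> (\<forall>n<N. F $ n = G $ n)"
proof
  assume "congr (fps_X ^ N) F G"
  then obtain H where H: "F - G = fps_X ^ N * H"
    by (auto simp: congr_def dvd_def)
  have "(F - G) $ n = 0" if "n < N" for n
    unfolding H using that by (simp add: fps_X_power_mult_nth)
  then show "\<forall>n<N. F $ n = G $ n" by simp
next
  assume eq: "\<forall>n<N. F $ n = G $ n"
  have "F - G = fps_X ^ N * Abs_fps (\<lambda>n. (F - G) $ (n + N))"
    using eq by (intro fps_ext) (auto simp: fps_X_power_mult_nth)
  then show "congr (fps_X ^ N) F G"
    unfolding congr_def by (metis dvd_triv_left)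
qed

text \<open>Testing only at multiples of 3 makes the truncation order divisible by 3, so that for a
  cube root of unity \<open>\<omega>\<close> the shift by \<open>N\<close> in
  \<open>\<omega> ^ (a + N)\<close> has no effect. Its positivity is what the finite triple product
  requires.\<close>

lemma congr_fps_eqI:
  fixes F G :: "'a::comm_ring_1 fps"
  assumes "\<And>N. N > 0 \<Longrightarrow> congr (fps_X ^ (3 * N)) F G"
  shows "F = G"
proof (rule fps_ext)
  fix n
  show "F $ n = G $ n"
    using assms[of "Suc n"] by (simp add: fps_congr_X_iff)
qed

lemma fps_unit_exists:
  fixes F :: "'a::comm_ring_1 fps"
  assumes "F $ 0 = 1"
  obtains G where "F * G = 1" "G $ 0 = 1"
proof
  show *: "F * fps_right_inverse F 1 = 1"
    by (rule fps_right_inverse) (simp add: assms)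
  show "fps_right_inverse F 1 $ 0 = 1"
    by simp
qed

lemma congr_poly_coeff:
  assumes "congr [:d:] p q"
  shows "congr d (coeff p k) (coeff q k)"
  proof -
  obtain r where "p - q = [:d:] * r" using assms by (auto simp: congr_def dvd_def)
  then have "coeff p k - coeff q k = d * coeff r k" by (simp flip: coeff_diff)
  then show ?thesis unfolding congr_def by (metis dvd_triv_left)
qed

lemma congr_poly_monom:
  assumes "congr d a b"
  shows "congr [:d:] (monom a k) (monom b k)"
proof -
  obtain c where "a - b = d * c" using assms by (auto simp: congr_def dvd_def)
  then have "monom a k - monom b k = [:d:] * monom c k"
    by (simp add: diff_monom smult_monom)
  then show ?thesis unfolding congr_def by (metis dvd_triv_left)
qed

subsection \<open>Gaussian binomials and the finite triple product\<close>

definition qpoch :: "'a::comm_ring_1 \<Rightarrow> nat \<Rightarrow> 'a" where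
  "qpoch q n = (\<Prod>i<n. 1 - q ^ Suc i)"

lemma qpoch_0 [simp]: "qpoch q 0 = 1"
  by (simp add: qpoch_def)

lemma qpoch_Suc: "qpoch q (Suc n) = qpoch q n * (1 - q ^ Suc n)"
  by (simp add: qpoch_def)

text \<open>The Pascal recursion defines Gaussian binomials without division, so they exist over
  polynomials and power series alike and commute with constant embeddings and with
  \<open>dil\<close>.\<close>

fun qbin :: "'a::comm_ring_1 \<Rightarrow> nat \<Rightarrow> nat \<Rightarrow> 'a" where
  "qbin q n 0 = 1"
| "qbin q 0 (Suc k) = 0"
| "qbin q (Suc n) (Suc k) = qbin q n (Suc k) + q ^ (n - k) * qbin q n k"

lemma qbin_eq_0: "n < k \<Longrightarrow> qbin q n k = 0"
  by (induction q n k rule: qbin.induct) auto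

lemma qbin_mult_qpoch:
  "k \<le> n \<Longrightarrow> qbin q n k * qpoch q k * qpoch q (n - k) = qpoch q n"
proof (induction n arbitrary: k)
  case 0
  then show ?case by simp
next
  case (Suc n)
  show ?case
  proof (cases k)
    case 0
    then show ?thesis by simp
  next
    case k: (Suc j)
    with Suc.prems have j: "j \<le> n" by simp
    have a: "qbin q n j * qpoch q j * qpoch q (n - j) = qpoch q n"
      using Suc.IH j by blast
    have b: "qbin q n (Suc j) * qpoch q (Suc j) * qpoch q (n - j) = qpoch q n * (1 - q ^ (n - j))"
    proof (cases "j = n")
      case True
      then show ?thesis by (simp add: qbin_eq_0)
    next
      case False
      with j have "n - j = Suc (n - Suc j)" "Suc j \<le> n" by auto
      with Suc.IH[of "Suc j"] show ?thesis
        by (metis mult.assoc qpoch_Suc)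
    qed
    have "q ^ (n - j) * q ^ Suc j = q ^ Suc n"
      using j by (metis Suc_diff_le add_Suc_right le_add_diff_inverse2 power_add)
    then have c: "q ^ (n - j) * (1 - q ^ Suc j) = q ^ (n - j) - q ^ Suc n"
      by (simp add: algebra_simps)
    have "qbin q (Suc n) k * qpoch q k * qpoch q (Suc n - k)
        = qbin q n (Suc j) * qpoch q (Suc j) * qpoch q (n - j)
        + qbin q n j * qpoch q j * qpoch q (n - j) * (q ^ (n - j) * (1 - q ^ Suc j))"
      unfolding k by (simp add: qpoch_Suc algebra_simps)
    also have "\<dots> = qpoch q n * (1 - q ^ (n - j)) + qpoch q n * (q ^ (n - j) - q ^ Suc n)"
      by (simp only: a b c)
    also have "\<dots> = qpoch q (Suc n)"
      by (simp add: qpoch_Suc algebra_simps)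
    finally show ?thesis .
  qed
qed

text \<open>Homogeneity in \<open>y\<close> permits \<open>y = q ^ (N - 1)\<close> below, in place
  of rescaling \<open>z\<close> by a negative power of \<open>q\<close>.\<close>

lemma qbinomial_theorem:
  fixes q y z :: "'a::comm_ring_1"
  shows "(\<Prod>i<n. y + z * q ^ i) = (\<Sum>k\<le>n. qbin q n k * q ^ (k choose
      2) * z ^ k * y ^ (n - k))"
proof (induction n)
  case 0
  show ?case by (simp add: binomial_eq_0)
next
  case (Suc n)
  define t where "t k = q ^ (k choose 2) * z ^ k" for k
  have ch: "t (Suc k) * q ^ (n - k) = t k * (z * q ^ n)" if "k \<le> n" for k
  proof -
    have "q ^ k * q ^ (n - k) = q ^ n"
      using that by (metis le_add_diff_inverse power_add)
    then have "z ^ Suc k * q ^ (k choose 2) * (q ^ k * q ^ (n - k)) = z ^ Suc k * q ^ (k choose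
        2) * q ^ n"
      by simp
    moreover have "q ^ (Suc k choose 2) = q ^ (k choose 2) * q ^ k"
      by (simp add: numeral_2_eq_2 power_add mult.commute)
    ultimately show ?thesis
      by (simp add: t_def mult_ac)
  qed
  have "(\<Prod>i<Suc n. y + z * q ^ i)
      = (\<Sum>k\<le>n. qbin q n k * t k * y ^ (n - k)) * (y + z * q ^ n)"
    using Suc.IH by (simp add: t_def mult_ac)
  also have "\<dots> = (\<Sum>k\<le>n. qbin q n k * t k * y ^ (Suc n - k))
      + (\<Sum>k\<le>n. qbin q n k * t k * (z * q ^ n) * y ^ (n - k))"
    by (simp only: distrib_left sum_distrib_right) (simp add: Suc_diff_le mult_ac)
  also have "(\<Sum>k\<le>n. qbin q n k * t k * (z * q ^ n) * y ^ (n - k))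
      = (\<Sum>k\<le>n. q ^ (n - k) * qbin q n k * t (Suc k) * y ^ (n - k))"
  proof (rule sum.cong[OF refl])
    fix k assume "k \<in> {..n}"
    then have "t (Suc k) * q ^ (n - k) = t k * (z * q ^ n)" using ch by simp
    then have "qbin q n k * y ^ (n - k) * (t (Suc k) * q ^ (n - k))
        = qbin q n k * y ^ (n - k) * (t k * (z * q ^ n))"
      by simp
    then show "qbin q n k * t k * (z * q ^ n) * y ^ (n - k)
        = q ^ (n - k) * qbin q n k * t (Suc k) * y ^ (n - k)"
      by (simp only: mult_ac)
  qed
  also have "(\<Sum>k\<le>n. qbin q n k * t k * y ^ (Suc n - k))
      = (\<Sum>k\<le>Suc n. qbin q n k * t k * y ^ (Suc n - k))"
    by (simp add: qbin_eq_0)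
  also have "\<dots> = y ^ Suc n + (\<Sum>k\<le>n. qbin q n (Suc k) * t (Suc k) * y ^ (n - k))"
    by (subst sum.atMost_Suc_shift) (simp add: t_def binomial_eq_0)
  also have "\<dots> + (\<Sum>k\<le>n. q ^ (n - k) * qbin q n k * t (Suc k) * y ^ (n - k))
      = (\<Sum>k\<le>Suc n. qbin q (Suc n) k * t k * y ^ (Suc n - k))"
    by (subst sum.atMost_Suc_shift) (simp add: t_def binomial_eq_0 sum.distrib[symmetric] algebra_simps)
  finally show ?case by (simp add: t_def mult.assoc)
qed

definition tri :: "int \<Rightarrow> nat" where
  "tri m = nat (m * (m + 1) div 2)"

lemma two_tri: "2 * int (tri m) = m * (m + 1)"
proof -
  have "even (m * (m + 1))" by simp
  moreover have "m * (m + 1) \<ge> 0"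
    by (cases "m \<ge> 0") (auto intro: mult_nonneg_nonneg mult_nonpos_nonpos)
  ultimately show ?thesis by (simp add: tri_def)
qed

text \<open>The q-binomial theorem with \<open>2 * N\<close> factors
  \<open>q ^ (N - 1) + z * q ^ i\<close>: the first half, read backwards, gives the factors
  \<open>q ^ i + z\<close>, the second half the factors \<open>1 + z * q ^ Suc i\<close>. The
  surplus power of \<open>q\<close> is cancelled at the end.\<close>

lemma finite_triple_product:
  fixes q z :: "'a::idom"
  assumes "q \<noteq> 0" "N > 0"
  shows "(\<Prod>i<N. (1 + z * q ^ Suc i) * (q ^ i + z))
    = (\<Sum>k\<le>2 * N. qbin q (2 * N) k * q ^ tri (int k - int N) * z ^ k)"
proof -
  \<comment> \<open>The surplus power of \<open>q\<close>: \<open>q ^ i\<close> from each factor of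
    the first half and \<open>q ^ (N - 1)\<close> from each factor of the second.\<close>
  define K where "K = N * (N - 1) + (\<Sum>i<N. i)"
  have "(\<Prod>i<2 * N. q ^ (N - 1) + z * q ^ i)
      = (\<Prod>i<N. q ^ (N - 1) + z * q ^ i) * (\<Prod>i<N. q ^ (N - 1) + z * q ^ (N + i))"
  proof -
    have "{..<2 * N} = {..<N} \<union> {N..<2*N}" by auto
    moreover have "(\<Prod>i\<in>{N..<2*N}. q ^ (N - 1) + z * q ^ i) = (\<Prod>i<N. q ^ (N - 1)
        + z * q ^ (N + i))"
      by (rule prod.reindex_bij_witness[of _ "\<lambda>i. N + i" "\<lambda>i. i - N"]) auto
    ultimately show ?thesis
      by (metis (no_types, lifting) finite_atLeastLessThan finite_lessThan ivl_disj_int_one(2)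
          prod.union_disjoint)
  qed
  also have "(\<Prod>i<N. q ^ (N - 1) + z * q ^ i) = (\<Prod>i<N. q ^ i * (q ^ (N - 1 - i) + z))"
  proof (rule prod.cong[OF refl])
    fix i assume "i \<in> {..<N}"
    then have "q ^ (N - 1) = q ^ i * q ^ (N - 1 - i)"
      by (subst power_add[symmetric]) auto
    then show "q ^ (N - 1) + z * q ^ i = q ^ i * (q ^ (N - 1 - i) + z)"
      by (simp add: algebra_simps)
  qed
  also have "\<dots> = (\<Prod>i<N. q ^ i) * (\<Prod>i<N. q ^ (N - 1 - i) + z)"
    by (simp add: prod.distrib)
  also have "(\<Prod>i<N. q ^ (N - 1 - i) + z) = (\<Prod>i<N. q ^ i + z)"
    using prod.nat_diff_reindex[of "\<lambda>i. q ^ i + z" N] by simp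
  also have "(\<Prod>i<N. q ^ i) = q ^ (\<Sum>i<N. i)"
    by (simp add: power_sum)
  also have "(\<Prod>i<N. q ^ (N - 1) + z * q ^ (N + i)) = (\<Prod>i<N. q ^ (N - 1) * (1 +
      z * q ^ Suc i))"
  proof (rule prod.cong[OF refl])
    fix i
    have "q ^ (N + i) = q ^ (N - 1) * q ^ Suc i"
      using assms by (subst power_add[symmetric]) auto
    then show "q ^ (N - 1) + z * q ^ (N + i) = q ^ (N - 1) * (1 + z * q ^ Suc i)"
      by (simp add: algebra_simps)
  qed
  also have "\<dots> = q ^ (N * (N - 1)) * (\<Prod>i<N. 1 + z * q ^ Suc i)"
    by (simp add: prod.distrib power_mult[symmetric] mult.commute)
  finally have 1: "(\<Prod>i<2 * N. q ^ (N - 1) + z * q ^ i)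
      = q ^ K * (\<Prod>i<N. (1 + z * q ^ Suc i) * (q ^ i + z))"
    by (simp add: K_def power_add prod.distrib mult_ac)
  have K2: "2 * int K = 3 * (int N * (int N - 1))"
  proof -
    have "2 * (\<Sum>i<N. i) = N * (N - 1)"
      by (induction N) (auto simp: algebra_simps)
    then have "2 * K = 3 * (N * (N - 1))" by (simp add: K_def)
    then have "int (2 * K) = int (3 * (N * (N - 1)))" by simp
    then show ?thesis using assms by (simp add: of_nat_diff)
  qed
  have ex: "(k choose 2) + (N - 1) * (2 * N - k) = K + tri (int k - int N)" if "k \<le> 2 * N" for k
  proof -
    have "2 * int (k choose 2) = int k * (int k - 1)"
      by (induction k) (auto simp: numeral_2_eq_2 algebra_simps)
    moreover have "int ((N - 1) * (2 * N - k)) = (int N - 1) * (2 * int N - int k)"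
      using that assms by (simp add: of_nat_diff)
    ultimately have "2 * int ((k choose 2) + (N - 1) * (2 * N - k)) = 2 * int (K + tri (int k - int N))"
      using K2 two_tri[of "int k - int N"] by (simp add: algebra_simps)
    then show ?thesis by (simp only: mult_cancel_left of_nat_eq_iff) simp
  qed
  have "(\<Prod>i<2 * N. q ^ (N - 1) + z * q ^ i)
      = (\<Sum>k\<le>2 * N. qbin q (2 * N) k * q ^ (k choose 2) * z ^ k * (q ^ (N - 1)) ^ (2 * N - k))"
    by (rule qbinomial_theorem)
  also have "\<dots> = (\<Sum>k\<le>2 * N. q ^ K * (qbin q (2 * N) k * q ^ tri (int k - int N) * z ^ k))"
  proof (rule sum.cong[OF refl])
    fix k assume "k \<in> {..2 * N}"
    then have "q ^ (k choose 2) * (q ^ (N - 1)) ^ (2 * N - k) = q ^ K * q ^ tri (int k - int N)"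
      using ex[of k] by (simp flip: power_mult power_add)
    then have "qbin q (2 * N) k * z ^ k * (q ^ (k choose 2) * (q ^ (N - 1)) ^ (2 * N - k))
        = qbin q (2 * N) k * z ^ k * (q ^ K * q ^ tri (int k - int N))"
      by simp
    then show "qbin q (2 * N) k * q ^ (k choose 2) * z ^ k * (q ^ (N - 1)) ^ (2 * N - k)
        = q ^ K * (qbin q (2 * N) k * q ^ tri (int k - int N) * z ^ k)"
      by (simp only: mult_ac)
  qed
  finally have "q ^ K * (\<Prod>i<N. (1 + z * q ^ Suc i) * (q ^ i + z))
      = q ^ K * (\<Sum>k\<le>2 * N. qbin q (2 * N) k * q ^ tri (int k - int N) * z ^ k)"
    by (simp only: 1 sum_distrib_left)
  then show ?thesis using assms by simp
qed

section \<open>The Euler product and the limit of the finite triple product\<close>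

lemma tri_lower: "\<bar>m\<bar> - 1 \<le> int (tri m)"
proof (cases "m \<ge> 0")
  case True
  have "0 \<le> m * (m - 1)"
    using True by (cases "m = 0") auto
  then show ?thesis using two_tri[of m] True by (simp add: algebra_simps)
next
  case False
  have "0 \<le> (- m - 1) * (- m - 2)"
    using False by (cases "m = -1") auto
  then show ?thesis using two_tri[of m] False by (simp add: algebra_simps)
qed

text \<open>The infinite product (q; q) as the diagonal of its partial products: the coefficient of
  \<open>fps_X ^ n\<close> is stationary from the n-th one on.\<close>

definition euler :: "'a::comm_ring_1 fps" where
  "euler = Abs_fps (\<lambda>n. qpoch fps_X n $ n)"

lemma qpoch_X_stable:
  "n \<le> M \<Longrightarrow> congr (fps_X ^ Suc n) (qpoch fps_X M) (qpoch (fps_X ::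
      'a::comm_ring_1 fps) n)"
proof (induction M rule: dec_induct)
  case base
  show ?case by simp
next
  case (step M)
  have "congr (fps_X ^ Suc n) (1 - fps_X ^ Suc M) (1 :: 'a fps)"
    using step by (simp add: congr_def le_imp_power_dvd del: power_Suc)
  from congr_mult[OF step.IH this] show ?case
    by (simp add: qpoch_Suc)
qed

lemma qpoch_X_euler: "congr (fps_X ^ Suc n) (qpoch fps_X n) (euler :: 'a::comm_ring_1 fps)"
  unfolding fps_congr_X_iff
proof (intro allI impI)
  fix m assume "m < Suc n"
  then have "congr (fps_X ^ Suc m) (qpoch fps_X n) (qpoch (fps_X :: 'a fps) m)"
    by (intro qpoch_X_stable) simp
  then show "qpoch fps_X n $ m = (euler :: 'a fps) $ m"
    unfolding fps_congr_X_iff by (simp add: euler_def)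
qed

lemma euler_0 [simp]: "euler $ 0 = 1"
  by (simp add: euler_def)

definition partition_gf :: "'a::comm_ring_1 fps" where
  "partition_gf = fps_right_inverse euler 1"

lemma euler_partition_gf: "euler * partition_gf = 1"
  unfolding partition_gf_def by (rule fps_right_inverse) simp

lemma congr_X_power_mono: "N \<le> M \<Longrightarrow> congr (x ^ M) a b \<Longrightarrow> congr
    (x ^ N) a b"
  unfolding congr_def by (meson dvd_trans le_imp_power_dvd)

text \<open>In \<open>qbin * qpoch k * qpoch (n - k) = qpoch n\<close> all three finite products
  agree with \<open>euler\<close> to order \<open>r\<close>, and two factors \<open>euler\<close>
  can be cancelled.\<close>

lemma qbin_X_congr:
  assumes "k \<le> n" "r \<le> k" "r \<le> n - k"
  shows "congr (fps_X ^ Suc r) (qbin fps_X n k) (partition_gf :: 'a::comm_ring_1 fps)"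
proof -
  let ?X = "fps_X :: 'a fps" and ?d = "(fps_X :: 'a fps) ^ Suc r"
  have q: "congr ?d (qpoch ?X m) euler" if "r \<le> m" for m
    by (rule congr_X_power_mono[OF _ qpoch_X_euler]) (use that in simp)
  have "congr ?d (qbin ?X n k * euler * euler) (qbin ?X n k * qpoch ?X k * qpoch ?X (n - k))"
    by (intro congr_mult congr_refl congr_sym[OF q] assms)
  also have "qbin ?X n k * qpoch ?X k * qpoch ?X (n - k) = qpoch ?X n"
    by (rule qbin_mult_qpoch) fact
  also have "congr ?d (qpoch ?X n) euler"
    by (rule q) (use assms in simp)
  finally have "congr ?d (euler * (euler * qbin ?X n k)) (euler * (euler * partition_gf))"
    by (simp add: euler_partition_gf mult_ac)
  from congr_unit_cancel[OF euler_partition_gf congr_unit_cancel[OF euler_partition_gf this]]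
  show ?thesis .
qed

text \<open>For \<open>a\<close> near the ends the Gaussian binomial is accurate only modulo
  \<open>fps_X ^ (N - |a| + 1)\<close>; the factor \<open>fps_X ^ tri a\<close> supplies the missing
  \<open>|a| - 1\<close>.\<close>

lemma tri_qbin_congr:
  assumes "\<bar>a\<bar> \<le> int N"
  shows "congr (fps_X ^ N) (qbin fps_X (2 * N) (nat (a + int N)) * fps_X ^ tri a)
    ((partition_gf :: 'a::comm_ring_1 fps) * fps_X ^ tri a)"
proof -
  define r where "r = nat (int N - \<bar>a\<bar>)"
  have "congr (fps_X ^ Suc r) (qbin fps_X (2 * N) (nat (a + int N))) (partition_gf :: 'a fps)"
    using assms by (intro qbin_X_congr) (auto simp: r_def)
  then obtain H where H: "qbin fps_X (2 * N) (nat (a + int N)) - partition_gf = fps_X ^ Suc r * (H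
      :: 'a fps)"
    unfolding congr_def dvd_def by blast
  have le: "N \<le> Suc r + tri a"
    using tri_lower[of a] assms by (simp add: r_def)
  have "qbin fps_X (2 * N) (nat (a + int N)) * fps_X ^ tri a - partition_gf * fps_X ^ tri a
      = (qbin fps_X (2 * N) (nat (a + int N)) - partition_gf) * fps_X ^ tri a"
    by (simp only: left_diff_distrib)
  also have "\<dots> = fps_X ^ (Suc r + tri a) * H"
    unfolding H by (simp only: power_add mult_ac)
  finally have "qbin fps_X (2 * N) (nat (a + int N)) * fps_X ^ tri a - partition_gf * fps_X ^ tri a
      = fps_X ^ (Suc r + tri a) * H" .
  then show ?thesis
    unfolding congr_def using le by (metis dvd_mult2 le_imp_power_dvd)
qed

text \<open>
  Polynomials in a formal variable \<open>z\<close> over power series in \<open>q\<close>.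
      Multiplying the truncated
  product by \<open>z ^ N\<close> avoids negative powers: the coefficient of \<open>z ^ (N +
      m)\<close> plays the role
  of the coefficient of \<open>z ^ m\<close> in the Jacobi triple product.
\<close>

definition trunc_prod :: "'a::idom fps \<Rightarrow> nat \<Rightarrow> 'a fps poly" where
  "trunc_prod \<zeta> N = (\<Prod>i<N. (1 + monom \<zeta> 1 * [:fps_X:] ^ Suc i) * ([:fps_X:] ^ i
      + monom \<zeta> 1))"

definition trunc_theta :: "(int \<Rightarrow> 'a::idom fps) \<Rightarrow> nat \<Rightarrow> 'a fps
    poly" where
  "trunc_theta c N = (\<Sum>a\<in>{- int N..int N}. monom (c a * fps_X ^ tri a) (nat (a + int N)))"

lemma const_poly_power: "[:c:] ^ n = [:c ^ n:]"
  by (induction n) (auto simp: one_pCons mult.commute)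

lemma qbin_const_poly: "qbin [:q:] n k = [:qbin q n k:]"
  by (induction q n k rule: qbin.induct) (auto simp: one_pCons const_poly_power)

lemma trunc_prod_expand:
  assumes "N > 0"
  shows "trunc_prod \<zeta> N = (\<Sum>a\<in>{- int N..int N}.
    monom (\<zeta> ^ nat (a + int N) * (qbin fps_X (2 * N) (nat (a + int N)) * fps_X ^ tri a))
        (nat (a + int N)))"
proof -
  have "trunc_prod \<zeta> N = (\<Sum>k\<le>2 * N. qbin [:fps_X:] (2 * N) k * [:fps_X:] ^ tri (int
      k - int N) * monom \<zeta> 1 ^ k)"
    unfolding trunc_prod_def by (rule finite_triple_product) (use assms in auto)
  also have "\<dots> = (\<Sum>k\<le>2 * N. monom (\<zeta> ^ k * (qbin fps_X (2 * N)
      k * fps_X ^ tri (int k - int N))) k)"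
    by (simp add: qbin_const_poly const_poly_power monom_power smult_monom mult_ac)
  also have "\<dots> = (\<Sum>a\<in>{- int N..int N}.
    monom (\<zeta> ^ nat (a + int N) * (qbin fps_X (2 * N) (nat (a + int N)) * fps_X ^ tri a))
        (nat (a + int N)))"
    by (rule sum.reindex_bij_witness[of _ "\<lambda>a. nat (a + int N)" "\<lambda>k. int k - int
        N"]) auto
  finally show ?thesis .
qed

text \<open>The Jacobi triple product to precision \<open>fps_X ^ N\<close>, with \<open>z\<close>
  scaled by \<open>\<zeta>\<close>.\<close>

lemma trunc_prod_congr:
  assumes "N > 0"
  shows "congr [:fps_X ^ N:] (trunc_prod \<zeta> N) ([:partition_gf:] * trunc_theta (\<lambda>a.
      \<zeta> ^ nat (a + int N)) N)"
proof -
  have "congr [:fps_X ^ N:] (trunc_prod \<zeta> N)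
     (\<Sum>a\<in>{- int N..int N}. monom (\<zeta> ^ nat (a + int
         N) * (partition_gf * fps_X ^ tri a)) (nat (a + int N)))"
    unfolding trunc_prod_expand[OF assms]
    by (intro congr_sum congr_poly_monom congr_mult congr_refl tri_qbin_congr) auto
  also have "(\<Sum>a\<in>{- int N..int N}. monom (\<zeta> ^ nat (a + int
      N) * (partition_gf * fps_X ^ tri a)) (nat (a + int N)))
    = [:partition_gf:] * trunc_theta (\<lambda>a. \<zeta> ^ nat (a + int N)) N"
    unfolding trunc_theta_def sum_distrib_left by (simp add: smult_monom mult_ac)
  finally show ?thesis .
qed

subsection \<open>Weighted generating functions\<close>

definition gf :: "'i set \<Rightarrow> ('i \<Rightarrow> nat) \<Rightarrow> ('i \<Rightarrow>
    'a::comm_ring_1) \<Rightarrow> 'a fps" where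
  "gf I w c = Abs_fps (\<lambda>n. \<Sum>i\<in>{i\<in>I. w i = n}. c i)"

text \<open>Infinite fibres would silently contribute \<open>0\<close> to
    \<^const>\<open>gf\<close>.\<close>

definition finite_fibres :: "'i set \<Rightarrow> ('i \<Rightarrow> nat) \<Rightarrow> bool" where
  "finite_fibres I w \<longleftrightarrow> (\<forall>n. finite {i\<in>I. w i = n})"

lemma gf_nth: "gf I w c $ n = (\<Sum>i\<in>{i\<in>I. w i = n}. c i)"
  by (simp add: gf_def)

lemma gf_cong: "I = J \<Longrightarrow> (\<And>i. i \<in> J \<Longrightarrow> w i = v i)
    \<Longrightarrow> (\<And>i. i \<in> J \<Longrightarrow> c i = d i) \<Longrightarrow> gf I w c =
    gf J v d"
  by (rule fps_ext) (auto simp: gf_nth intro!: sum.cong)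

lemma gf_reindex:
  assumes "\<And>j. j \<in> J \<Longrightarrow> h (g j) = j" "\<And>j. j \<in> J \<Longrightarrow>
      g j \<in> I"
    and "\<And>i. i \<in> I \<Longrightarrow> g (h i) = i" "\<And>i. i \<in> I \<Longrightarrow>
        h i \<in> J"
    and w: "\<And>j. j \<in> J \<Longrightarrow> w (g j) = v j" and c: "\<And>j. j \<in> J
        \<Longrightarrow> c (g j) = d j"
  shows "gf I w c = gf J v d"
proof (rule fps_ext)
  fix n
  have v: "v (h i) = w i" "d (h i) = c i" if "i \<in> I" for i
    using assms(3,4) w c that by metis+
  show "gf I w c $ n = gf J v d $ n"
    unfolding gf_nth
    by (rule sum.reindex_bij_witness[of _ g h]) (simp_all add: assms v)
qed

lemma finite_fibresD:
  assumes "finite_fibres I w"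
  shows "finite {i\<in>I. w i = n}" "finite {i\<in>I. w i \<le> n}"
proof -
  show "finite {i\<in>I. w i = n}" using assms by (simp add: finite_fibres_def)
  have "{i\<in>I. w i \<le> n} = (\<Union>m\<le>n. {i\<in>I. w i = m})" by auto
  then show "finite {i\<in>I. w i \<le> n}" using assms by (simp add: finite_fibres_def)
qed

lemma finite_fibres_subset:
  assumes "finite_fibres I w" "J \<subseteq> I"
  shows "finite_fibres J w"
  unfolding finite_fibres_def
proof
  fix n
  show "finite {i\<in>J. w i = n}"
    by (rule finite_subset[OF _ finite_fibresD(1)[OF assms(1), of n]]) (use assms(2) in auto)
qed

lemma finite_fibres_Times:
  assumes "finite_fibres I w" "finite_fibres J v"
  shows "finite_fibres (I \<times> J) (\<lambda>(i, j). w i + v j)"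
  unfolding finite_fibres_def
proof
  fix n
  have "{x \<in> I \<times> J. (case x of (i, j) \<Rightarrow> w i + v j) = n} \<subseteq>
      {i\<in>I. w i \<le> n} \<times> {j\<in>J. v j \<le> n}"
    by auto
  then show "finite {x \<in> I \<times> J. (case x of (i, j) \<Rightarrow> w i + v j) = n}"
    by (rule finite_subset) (simp add: assms finite_fibresD(2))
qed

lemma gf_times:
  assumes "finite_fibres I w" "finite_fibres J v"
  shows "gf I w c * gf J v d = gf (I \<times> J) (\<lambda>(i, j). w i + v j) (\<lambda>(i, j). c
      i * d j)"
proof (rule fps_ext)
  fix n
  have "gf (I \<times> J) (\<lambda>(i, j). w i + v j) (\<lambda>(i, j). c i * d j) $ n
      = (\<Sum>x\<in>{x \<in> I \<times> J. (case x of (i, j) \<Rightarrow> w i + v j) = n}. c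
          (fst x) * d (snd x))"
    by (simp add: gf_nth case_prod_unfold)
  also have "\<dots> = (\<Sum>k\<in>{0..n}. \<Sum>x\<in>{x \<in> {x \<in> I \<times> J. (case x of
      (i, j) \<Rightarrow> w i + v j) = n}. w (fst x) = k}. c (fst x) * d (snd x))"
    by (rule sum.group[symmetric]) (use finite_fibres_Times[OF assms] in \<open>auto simp:
        finite_fibres_def\<close>)
  also have "\<dots> = (\<Sum>k\<in>{0..n}. gf I w c $ k * gf J v d $ (n - k))"
  proof (rule sum.cong[OF refl])
    fix k assume "k \<in> {0..n}"
    then have "{x \<in> {x \<in> I \<times> J. (case x of (i, j) \<Rightarrow> w i + v j) = n}.
        w (fst x) = k}
      = {i\<in>I. w i = k} \<times> {j\<in>J. v j = n - k}" by auto
    then show "(\<Sum>x\<in>{x \<in> {x \<in> I \<times> J. (case x of (i, j) \<Rightarrow> w i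
        + v j) = n}. w (fst x) = k}. c (fst x) * d (snd x))
      = gf I w c $ k * gf J v d $ (n - k)"
      by (simp add: gf_nth sum_product sum.cartesian_product case_prod_unfold)
  qed
  finally show "(gf I w c * gf J v d) $ n = gf (I \<times> J) (\<lambda>(i, j). w i + v j)
      (\<lambda>(i, j). c i * d j) $ n"
    by (simp add: fps_mult_nth)
qed

lemma gf_partition:
  assumes "finite_fibres I w" "finite R" "\<rho> ` I \<subseteq> R"
  shows "gf I w c = (\<Sum>r\<in>R. gf {i\<in>I. \<rho> i = r} w c)"
proof (rule fps_ext)
  fix n
  have "gf I w c $ n = (\<Sum>r\<in>R. \<Sum>i\<in>{i\<in>{i\<in>I. w i = n}. \<rho> i = r}. c i)"
    unfolding gf_nth by (rule sum.group[symmetric]) (use assms in \<open>auto simp: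
        finite_fibresD(1)\<close>)
  also have "\<dots> = (\<Sum>r\<in>R. gf {i\<in>I. \<rho> i = r} w c) $ n"
    unfolding fps_sum_nth gf_nth by (intro sum.cong) auto
  finally show "gf I w c $ n = (\<Sum>r\<in>R. gf {i\<in>I. \<rho> i = r} w c) $ n" .
qed

lemma gf_shift: "fps_X ^ k * gf I w c = gf I (\<lambda>i. w i + k) c"
proof (rule fps_ext)
  fix n
  have "n \<ge> k \<Longrightarrow> {i\<in>I. w i = n - k} = {i\<in>I. w i + k = n}" by auto
  moreover have "n < k \<Longrightarrow> {i\<in>I. w i + k = n} = {}" by auto
  ultimately show "(fps_X ^ k * gf I w c) $ n = gf I (\<lambda>i. w i + k) c $ n"
    by (auto simp: fps_X_power_mult_nth gf_nth)
qed

lemma gf_scale: "gf I w (\<lambda>i. k * c i) = fps_const k * gf I w c"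
  by (rule fps_ext) (simp add: gf_nth sum_distrib_left)

lemma gf_truncate:
  assumes "finite J" "J \<subseteq> I" "\<And>i. i \<in> I - J \<Longrightarrow> N \<le> w i"
  shows "congr (fps_X ^ N) (\<Sum>i\<in>J. fps_const (c i) * fps_X ^ w i) (gf I w c)"
  unfolding fps_congr_X_iff
proof (intro allI impI)
  fix n assume "n < N"
  then have "{i\<in>I. w i = n} = {i\<in>J. w i = n}"
    using assms(2,3) by fastforce
  moreover have "(\<Sum>i\<in>J. fps_const (c i) * fps_X ^ w i) $ n = (\<Sum>i\<in>J. if w i = n
      then c i else 0)"
    by (auto simp: fps_sum_nth intro!: sum.cong)
  ultimately show "(\<Sum>i\<in>J. fps_const (c i) * fps_X ^ w i) $ n = gf I w c $ n"
    using assms(1) by (simp add: gf_nth sum.inter_filter)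
qed

subsection \<open>Frobenius partitions as pairs of sets\<close>

lemma colored_less_iff: "colored_less x y \<longleftrightarrow> x < y"
  by (auto simp: colored_less_def less_prod_def)

lemma frobenius_row_iff:
  "frobenius_row k xs \<longleftrightarrow> set xs \<subseteq> colored_nats k \<and> rev
      (sorted_list_of_set (set xs)) = xs"
proof -
  have "sorted_wrt (\<lambda>x y. colored_less y x) xs \<longleftrightarrow> sorted_wrt (<) (rev xs)"
    by (simp add: sorted_wrt_rev colored_less_iff)
  also have "\<dots> \<longleftrightarrow> sorted_list_of_set (set (rev xs)) = rev xs"
    by (metis List.finite_set sorted_list_of_set.idem_if_sorted_distinct
        sorted_list_of_set.strict_sorted_key_list_of_set strict_sorted_iff map_ident)
  also have "\<dots> \<longleftrightarrow> rev (sorted_list_of_set (set xs)) = xs"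
    by (metis rev_swap set_rev)
  finally show ?thesis by (simp add: frobenius_row_def)
qed

lemma sum_nth_eq_sum_set:
  assumes "rev (sorted_list_of_set (set xs)) = xs"
  shows "(\<Sum>i<length xs. g (xs ! i)) = sum g (set xs)"
proof -
  have d: "distinct xs" using assms by (metis distinct_rev distinct_sorted_list_of_set)
  have "(\<Sum>i<length xs. g (xs ! i)) = sum_list (map g xs)"
    by (simp add: sum_list_sum_nth atLeast0LessThan)
  also have "\<dots> = sum g (set xs)"
    by (rule sum_list_distinct_conv_sum_set[OF d])
  finally show ?thesis .
qed

text \<open>A strictly decreasing row is determined by its set of entries. The summand
  \<open>r\<close> is absorbed by counting \<open>a + 1\<close> for each entry of the first row, and
  entries of a partition of \<open>n\<close> are at most \<open>n\<close>, so the finite universe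
  \<open>U\<close> suffices.\<close>

lemma cphi_eq_card_sets:
  fixes k :: nat
  assumes "n < N"
  defines "U \<equiv> {..<N} \<times> {1..k}"
  shows "cphi k n = card {(S, T). S \<subseteq> U \<and> T \<subseteq> U \<and> card S = card T \<and>
    (\<Sum>x\<in>S. Suc (fst x)) + (\<Sum>x\<in>T. fst x) = n}"
proof -
  let ?P = "{(S, T). S \<subseteq> U \<and> T \<subseteq> U \<and> card S = card T \<and>
      (\<Sum>x\<in>S. Suc (fst x)) + (\<Sum>x\<in>T. fst x) = n}"
  let ?l = "\<lambda>S. rev (sorted_list_of_set S) :: (nat \<times> nat) list"
  have finU: "finite U" by (simp add: U_def)
  have len: "length xs = card (set xs)" if "?l (set xs) = xs" for xs
    using that by (metis distinct_card distinct_rev distinct_sorted_list_of_set)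
  have mem: "(as, bs) \<in> gen_frobenius_partitions k n \<longleftrightarrow>
      (set as, set bs) \<in> ?P \<and> ?l (set as) = as \<and> ?l (set bs) = bs" for as bs
  proof (cases "?l (set as) = as \<and> ?l (set bs) = bs")
    case True
    note l = len[of as] len[of bs] sum_nth_eq_sum_set[of as fst] sum_nth_eq_sum_set[of bs fst]
    have eq: "length as + (\<Sum>i<length as. fst (as ! i) + fst (bs ! i))
        = (\<Sum>x\<in>set as. Suc (fst x)) + (\<Sum>x\<in>set bs. fst x)" if "length as = length bs"
      using l True that by (simp add: sum.distrib sum_Suc)
    have small: "set xs \<subseteq> U" if "set xs \<subseteq> colored_nats k" "(\<Sum>x\<in>set
        xs. fst x) \<le> n" for xs
    proof
      fix x assume x: "x \<in> set xs"
      then have "fst x \<le> n"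
        using that(2) member_le_sum[of x "set xs" fst] by simp
      then show "x \<in> U"
        using x that(1) assms(1) by (auto simp: U_def colored_nats_def)
    qed
    have big: "set xs \<subseteq> U \<Longrightarrow> set xs \<subseteq> colored_nats k" for xs
      by (auto simp: U_def colored_nats_def)
    have "(\<Sum>x\<in>set as. fst x) \<le> (\<Sum>x\<in>set as. Suc (fst x))"
      by (rule sum_mono) simp
    then show ?thesis
      using True eq small[of as] small[of bs] big[of as] big[of bs] l
      unfolding gen_frobenius_partitions_def frobenius_row_iff
      by auto
  next
    case False
    then show ?thesis
      by (auto simp: gen_frobenius_partitions_def frobenius_row_iff)
  qed
  have "bij_betw (\<lambda>(S, T). (?l S, ?l T)) ?P (gen_frobenius_partitions k n)"
  proof (rule bij_betwI[where g = "\<lambda>(as, bs). (set as, set bs)"])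
    show "(\<lambda>(S, T). (?l S, ?l T)) \<in> ?P \<rightarrow> gen_frobenius_partitions k n"
    proof
      fix p assume p: "p \<in> ?P"
      obtain S T where [simp]: "p = (S, T)" by (cases p)
      have "finite S" "finite T" using p finU by (auto intro: finite_subset)
      then show "(\<lambda>(S, T). (?l S, ?l T)) p \<in> gen_frobenius_partitions k n"
        using p by (simp add: mem)
    qed
    show "(\<lambda>(as, bs). (set as, set bs)) \<in> gen_frobenius_partitions k n \<rightarrow> ?P"
      using mem by auto
    show "(\<lambda>(as, bs). (set as, set bs)) ((\<lambda>(S, T). (?l S, ?l T)) p) = p" if "p
        \<in> ?P" for p
    proof -
      obtain S T where [simp]: "p = (S, T)" by (cases p)
      have "finite S" "finite T" using that finU by (auto intro: finite_subset)
      then show ?thesis by simp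
    qed
    show "(\<lambda>(S, T). (?l S, ?l T)) ((\<lambda>(as, bs). (set as, set bs)) p) = p"
      if "p \<in> gen_frobenius_partitions k n" for p
      using that mem[of "fst p" "snd p"] by (simp add: case_prod_unfold)
  qed
  then show ?thesis
    unfolding cphi_def by (metis (no_types, lifting) bij_betw_same_card)
qed

lemma prod_monom: "finite S \<Longrightarrow> (\<Prod>x\<in>S. monom (a x) (d x)) = monom
    (\<Prod>x\<in>S. a x) (\<Sum>x\<in>S. d x)"
  by (induction S rule: finite_induct) (auto simp: mult_monom)

text \<open>When the product is expanded over \<open>U\<close>, the set \<open>S\<close> records the
  factors \<open>1 + z q ^ (a + 1)\<close> that contribute their second term, and \<open>T\<close>
  the factors \<open>q ^ b + z\<close> that contribute \<open>q ^ b\<close>. The degree in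
  \<open>z\<close> is \<open>card S + card U - card T\<close>, so the coefficient at
  \<open>card U = k * N\<close> enforces equal row lengths.\<close>

lemma cphi_eq_coeff:
  assumes "n < N"
  shows "of_nat (cphi k n) = coeff (trunc_prod (1::'a::idom fps) N ^ k) (k * N) $ n"
proof -
  define U where "U = {..<N} \<times> {1..k}"
  have finU: "finite U" by (simp add: U_def)
  have cardU: "card U = k * N" by (simp add: U_def mult.commute)
  let ?z = "monom (1::'a fps) 1"
  define A where "A S = (\<Sum>x\<in>S. Suc (fst (x :: nat \<times> nat)))" for S
  define B where "B T = (\<Sum>x\<in>T. fst (x :: nat \<times> nat))" for T
  have "trunc_prod (1::'a fps) N ^ k
      = (\<Prod>i<N. \<Prod>c\<in>{1..k}. (1 + ?z * [:fps_X:] ^ Suc i) * ([:fps_X:] ^ i + ?z))"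
    unfolding trunc_prod_def by (simp add: prod_power_distrib)
  also have "\<dots> = (\<Prod>x\<in>U. (1 + ?z * [:fps_X:] ^ Suc (fst x)) * ([:fps_X:] ^ fst x + ?z))"
    unfolding U_def by (subst prod.cartesian_product) (simp add: case_prod_unfold)
  also have "\<dots> = (\<Prod>x\<in>U. monom (fps_X ^ Suc (fst x)) 1 + 1) * (\<Prod>x\<in>U.
      monom (fps_X ^ fst x) 0 + ?z)"
    by (simp add: prod.distrib const_poly_power smult_monom monom_0 add.commute mult.commute)
  also have "(\<Prod>x\<in>U. monom (fps_X ^ Suc (fst x)) 1 + (1::'a fps poly))
      = (\<Sum>S\<in>Pow U. monom (fps_X ^ A S) (card S))"
  proof -
    have "(\<Prod>x\<in>S. monom (fps_X ^ Suc (fst x)) 1) = monom ((fps_X::'a fps) ^ A S) (card S)"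
      if "S \<subseteq> U" for S
      using finite_subset[OF that finU] by (simp add: prod_monom A_def power_sum del: power_Suc)
    then show ?thesis by (simp add: prod_add[OF finU])
  qed
  also have "(\<Prod>x\<in>U. monom (fps_X ^ fst x) 0 + ?z)
      = (\<Sum>T\<in>Pow U. monom (fps_X ^ B T) (card U - card T))"
  proof -
    have "(\<Prod>x\<in>T. monom (fps_X ^ fst x) 0) * (\<Prod>x\<in>U - T. ?z)
        = monom ((fps_X::'a fps) ^ B T) (card U - card T)"
      if "T \<subseteq> U" for T
      using finite_subset[OF that finU] that finU
      by (simp add: prod_monom B_def power_sum monom_power mult_monom card_Diff_subset)
    then show ?thesis by (simp add: prod_add[OF finU])
  qed
  finally have "trunc_prod (1::'a fps) N ^ k
      = (\<Sum>(S, T)\<in>Pow U \<times> Pow U. monom (fps_X ^ (A S + B T)) (card S + (card U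
          - card T)))"
    by (simp add: sum_product sum.cartesian_product mult_monom power_add)
  then have "coeff (trunc_prod (1::'a fps) N ^ k) (k * N) $ n
      = (\<Sum>p\<in>Pow U \<times> Pow U. if card (fst p) = card (snd p) \<and> A (fst p) + B
          (snd p) = n then 1 else 0)"
  proof -
    have card: "(card S + (card U - card T) = k * N) = (card S = card T)" if "T \<subseteq> U" for S T
      using card_mono[OF finU that] by (auto simp: cardU)
    show ?thesis if "trunc_prod (1::'a fps) N ^ k
      = (\<Sum>(S, T)\<in>Pow U \<times> Pow U. monom (fps_X ^ (A S + B T)) (card S + (card U
          - card T)))"
      unfolding that coeff_sum fps_sum_nth
      by (intro sum.cong) (auto simp: card coeff_monom)
  qed
  also have "\<dots> = of_nat (card {p\<in>Pow U \<times> Pow U. card (fst p) = card (snd p)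
      \<and> A (fst p) + B (snd p) = n})"
    using finU by (simp add: sum.inter_filter[symmetric])
  also have "{p\<in>Pow U \<times> Pow U. card (fst p) = card (snd p) \<and> A (fst p) + B (snd p) = n}
      = {(S, T). S \<subseteq> U \<and> T \<subseteq> U \<and> card S = card T \<and>
          (\<Sum>x\<in>S. Suc (fst x)) + (\<Sum>x\<in>T. fst x) = n}"
    by (auto simp: A_def B_def)
  finally show ?thesis
    using cphi_eq_card_sets[OF assms, of k] by (simp add: U_def)
qed

subsection \<open>Dilation and trisection of power series\<close>

definition dil :: "'a::idom fps \<Rightarrow> 'a fps" where
  "dil F = F oo fps_X ^ 3"

definition sect :: "nat \<Rightarrow> 'a::zero fps \<Rightarrow> 'a fps" where
  "sect r F = Abs_fps (\<lambda>n. F $ (3 * n + r))"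

lemma dil_nth: "dil F $ n = (if 3 dvd n then F $ (n div 3) else 0)"
  by (simp add: dil_def fps_nth_compose_X_power)

lemma dil_add: "dil (F + G) = dil F + dil G"
  by (rule fps_ext) (simp add: dil_nth)

lemma dil_diff: "dil (F - G) = dil F - dil G"
  by (rule fps_ext) (simp add: dil_nth)

lemma dil_mult: "dil (F * G) = dil F * dil G"
  unfolding dil_def by (rule fps_compose_mult_distrib) simp

lemma dil_1 [simp]: "dil 1 = 1"
  by (simp add: dil_def)

lemma dil_0 [simp]: "dil 0 = 0"
  by (simp add: dil_def)

lemma dil_power: "dil (F ^ n) = dil F ^ n"
  by (induction n) (auto simp: dil_mult)

lemma dil_X [simp]: "dil fps_X = fps_X ^ 3"
  by (rule fps_ext) (auto simp: dil_nth)

lemma dil_of_nat [simp]: "dil (of_nat k) = of_nat k"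
  by (induction k) (auto simp: dil_add)

lemma dil_numeral [simp]: "dil (numeral k) = numeral k"
  using dil_of_nat[of "numeral k"] by simp

lemma dil_qbin: "dil (qbin q n k) = qbin (dil q) n k"
  by (induction q n k rule: qbin.induct) (auto simp: dil_mult dil_add dil_power)

lemma dil_congr: "congr (fps_X ^ N) F G \<Longrightarrow> congr (fps_X ^ N) (dil F) (dil G)"
  by (auto simp: fps_congr_X_iff dil_nth)

lemma dil_gf: "dil (gf I w c) = gf I (\<lambda>i. 3 * w i) c"
proof (rule fps_ext)
  fix n
  have "3 dvd n \<Longrightarrow> {i\<in>I. w i = n div 3} = {i\<in>I. 3 * w i = n}" by auto
  moreover have "\<not> 3 dvd n \<Longrightarrow> sum c {i\<in>I. 3 * w i = n} = 0"
    by (rule sum.neutral) auto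
  ultimately show "dil (gf I w c) $ n = gf I (\<lambda>i. 3 * w i) c $ n"
    by (simp add: dil_nth gf_nth)
qed

text \<open>Trisection is linear over the series in \<open>q ^ 3\<close>; prefactors of the form
  \<open>dil G\<close> therefore pass through it undilated.\<close>

lemma sect_dil_mult:
  assumes "r < 3"
  shows "sect r (dil G * F) = G * sect r F"
proof (rule fps_ext)
  fix n
  have "sect r (dil G * F) $ n = (\<Sum>i\<in>{0..3 * n + r}. dil G $ i * F $ (3 * n + r - i))"
    by (simp add: sect_def fps_mult_nth)
  also have "\<dots> = (\<Sum>i\<in>(\<lambda>j. 3 * j) ` {0..n}. dil G $ i * F $ (3 * n + r - i))"
  proof (rule sum.mono_neutral_right)
    show "\<forall>i\<in>{0..3 * n + r} - (\<lambda>j. 3 * j) ` {0..n}. dil G $ i * F $ (3 * n +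
        r - i) = 0"
      using assms by (auto simp: dil_nth image_iff elim!: dvdE)
  qed auto
  also have "\<dots> = (\<Sum>j\<in>{0..n}. G $ j * F $ (3 * (n - j) + r))"
    by (subst sum.reindex) (auto simp: inj_on_def dil_nth diff_mult_distrib2 intro!: sum.cong)
  also have "\<dots> = (G * sect r F) $ n"
    by (simp add: sect_def fps_mult_nth)
  finally show "sect r (dil G * F) $ n = (G * sect r F) $ n" .
qed

lemma sect_add: "sect r (F + G) = sect r F + sect r (G :: 'a::comm_ring_1 fps)"
  by (rule fps_ext) (simp add: sect_def)

lemma sect_X_power: "r < 3 \<Longrightarrow> s < 3 \<Longrightarrow> sect r (fps_X ^ s) = (if r = s
    then 1 else 0)"
  by (rule fps_ext) (auto simp: sect_def)

lemma monom_sum_cube: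
  shows "(\<Sum>i\<in>I. monom (m1 i) (d i)) * (\<Sum>i\<in>I. monom (m2 i) (d
      i)) * (\<Sum>i\<in>I. monom (m3 i) (d i))
    = (\<Sum>(i, j, k)\<in>I \<times> I \<times> I. monom (m1 i * m2 j * m3 k ::
        'a::comm_ring_1) (d i + d j + d k))"
proof -
  have "(\<Sum>(i, j, k)\<in>I \<times> I \<times> I. monom (m1 i * m2 j * m3 k) (d i + d j + d k))
    = (\<Sum>i\<in>I. \<Sum>j\<in>I. \<Sum>k\<in>I. monom (m1 i) (d i) * (monom (m2 j) (d
        j) * monom (m3 k) (d k)))"
    by (simp add: sum.cartesian_product mult_monom case_prod_unfold mult.assoc add.assoc)
  also have "\<dots> = (\<Sum>i\<in>I. monom (m1 i) (d i)) * ((\<Sum>i\<in>I. monom (m2 i) (d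
      i)) * (\<Sum>i\<in>I. monom (m3 i) (d i)))"
    by (simp only: sum_distrib_left[symmetric] sum_distrib_right[symmetric])
  finally show ?thesis by (simp only: mult.assoc)
qed

subsection \<open>Theta series of the hexagonal lattice\<close>

type_synonym int3 = "int \<times> int \<times> int"

fun tsum :: "int3 \<Rightarrow> int" where "tsum (a, b, c) = a + b + c"

text \<open>On triples with \<open>a + b + c = s\<close> this is half of
  \<open>a ^ 2 + b ^ 2 + c ^ 2 + s\<close>: up to a constant, the hexagonal norm form on the lattice
  (\<open>s = 0\<close>) or on a translate of it.\<close>

fun twt :: "int3 \<Rightarrow> nat" where "twt (a, b, c) = tri a + tri b + tri c"

definition row :: "int \<Rightarrow> int3 set" where "row s = {p. tsum p = s}"

lemma row_iff [simp]: "(a, b, c) \<in> row s \<longleftrightarrow> a + b + c = s"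
  by (simp add: row_def)

lemma two_twt: "2 * int (twt (a, b, c)) = a * (a + 1) + b * (b + 1) + c * (c + 1)"
  using two_tri[of a] two_tri[of b] two_tri[of c] by simp

lemma finite_fibres_twt: "finite_fibres I twt"
proof -
  have "finite {p \<in> UNIV. twt p = n}" for n
  proof (rule finite_subset)
    let ?I = "{- int n - 1..int n + 1}"
    show "{p \<in> UNIV. twt p = n} \<subseteq> ?I \<times> ?I \<times> ?I"
    proof
      fix p assume p: "p \<in> {p \<in> UNIV. twt p = n}"
      obtain a b c where [simp]: "p = (a, b, c)" by (cases p)
      from p have "tri a \<le> n" "tri b \<le> n" "tri c \<le> n" by auto
      then show "p \<in> ?I \<times> ?I \<times> ?I"
        using tri_lower[of a] tri_lower[of b] tri_lower[of c] by auto
    qed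
    show "finite (?I \<times> ?I \<times> ?I)" by simp
  qed
  then have "finite_fibres UNIV twt" by (simp add: finite_fibres_def)
  then show ?thesis by (rule finite_fibres_subset) simp
qed

lemma tri_ge_outside:
  assumes "N > 0" "a \<notin> {- int N..int N}"
  shows "N \<le> tri a"
proof -
  have "int N + 1 \<le> \<bar>a\<bar>" using assms by auto
  then show ?thesis using tri_lower[of a] by linarith
qed

text \<open>Each coordinate carries degree \<open>a + N\<close> in \<open>z\<close>, so degree
  \<open>3 * N\<close> selects \<open>a + b + c = 0\<close>; triples cut off by the truncation have
  weight at least \<open>N\<close>.\<close>

lemma trunc_theta3_coeff:
  assumes "N > 0"
  shows "congr (fps_X ^ N)
    (coeff (trunc_theta (\<lambda>a. fps_const (u a)) N * trunc_theta (\<lambda>a. fps_const (v a)) N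
      * trunc_theta (\<lambda>a. fps_const (w a)) N) (3 * N))
    (gf (row 0) twt (\<lambda>(a, b, c). u a * v b * w c :: 'a::idom))"
proof -
  let ?I = "{- int N..int N}"
  have "coeff (trunc_theta (\<lambda>a. fps_const (u a)) N * trunc_theta (\<lambda>a. fps_const (v a)) N
      * trunc_theta (\<lambda>a. fps_const (w a)) N) (3 * N)
    = (\<Sum>(a, b, c)\<in>?I \<times> ?I \<times> ?I. if a + b + c = 0 then
        fps_const (u a * v b * w c) * fps_X ^ twt (a, b, c) else 0)"
    unfolding trunc_theta_def monom_sum_cube coeff_sum
    by (rule sum.cong) (auto simp: coeff_monom power_add mult_ac simp flip: fps_const_mult)
  also have "\<dots> = (\<Sum>p\<in>{p \<in> ?I \<times> ?I \<times> ?I. p \<in> row 0}.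
        fps_const (case p of (a, b, c) \<Rightarrow> u a * v b * w c) * fps_X ^ twt p)"
    by (subst sum.inter_filter) (auto intro!: sum.cong)
  also have "congr (fps_X ^ N) \<dots> (gf (row 0) twt (\<lambda>(a, b, c). u a * v b * w c))"
  proof (rule gf_truncate)
    fix p assume p: "p \<in> row 0 - {p \<in> ?I \<times> ?I \<times> ?I. p \<in> row 0}"
    obtain a b c where [simp]: "p = (a, b, c)" by (cases p)
    from p have "a \<notin> ?I \<or> b \<notin> ?I \<or> c \<notin> ?I" by auto
    then have "N \<le> tri a \<or> N \<le> tri b \<or> N \<le> tri c"
      using tri_ge_outside[OF assms] by blast
    then show "N \<le> twt p" by auto
  qed auto
  finally show ?thesis .
qed

text \<open>The nine coordinates are grouped into three triples at once, because the later
  decomposition sorts by triple sums. A triple of sum \<open>s\<close> has degree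
  \<open>s + 3 * N\<close>, so degree \<open>9 * N\<close> selects total sum 0.\<close>

lemma trunc_theta9_coeff:
  assumes "N > 0"
  shows "congr (fps_X ^ N) (coeff (trunc_theta (\<lambda>_. 1) N ^ 9) (9 * N))
    (gf {(p1, p2, p3). tsum p1 + tsum p2 + tsum p3 = 0} (\<lambda>(p1, p2, p3). twt p1 + twt p2 + twt p3)
      (\<lambda>_. 1 :: 'a::idom))"
proof -
  let ?I = "{- int N..int N}"
  let ?J = "?I \<times> ?I \<times> ?I"
  let ?d = "\<lambda>a. nat (a + int N)"
  let ?D = "\<lambda>(a, b, c). ?d a + ?d b + ?d c"
  let ?W = "\<lambda>(p1, p2, p3). twt p1 + twt p2 + twt p3"
  let ?S = "{(p1, p2, p3). tsum p1 + tsum p2 + tsum p3 = 0}"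
  let ?T = "trunc_theta (\<lambda>_. 1 :: 'a fps) N"
  have cube: "?T * ?T * ?T = (\<Sum>p\<in>?J. monom (fps_X ^ twt p) (?D p))"
    unfolding trunc_theta_def monom_sum_cube
    by (rule sum.cong) (auto simp: power_add)
  have D: "?D p = nat (tsum p + 3 * int N)" "0 \<le> tsum p + 3 * int N" if "p \<in> ?J" for p
    using that by auto
  have pow9: "?T ^ 9 = (?T * ?T * ?T) * (?T * ?T * ?T) * (?T * ?T * ?T)"
    by (simp only: power3_eq_cube[symmetric] power_mult[symmetric]) simp
  have "coeff (?T ^ 9) (9 * N) = (\<Sum>(p1, p2, p3)\<in>?J \<times> ?J \<times> ?J.
      if tsum p1 + tsum p2 + tsum p3 = 0 then fps_X ^ twt p1 * fps_X ^ twt p2 * fps_X ^ twt p3 else 0)"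
    unfolding pow9 cube monom_sum_cube coeff_sum
  proof (rule sum.cong[OF refl])
    fix x assume x: "x \<in> ?J \<times> ?J \<times> ?J"
    obtain p1 p2 p3 where x_eq: "x = (p1, p2, p3)" by (cases x)
    have "?D p1 + ?D p2 + ?D p3 = 9 * N \<longleftrightarrow> tsum p1 + tsum p2 + tsum p3 = 0"
    proof -
      have m: "p1 \<in> ?J" "p2 \<in> ?J" "p3 \<in> ?J" using x unfolding x_eq by blast+
      show ?thesis
        unfolding D(1)[OF m(1)] D(1)[OF m(2)] D(1)[OF m(3)]
        using D(2)[OF m(1)] D(2)[OF m(2)] D(2)[OF m(3)] by linarith
    qed
    then show "coeff (case x of (i, j, k) \<Rightarrow> monom (fps_X ^ twt i * fps_X ^ twt
        j * fps_X ^ twt k) (?D i + ?D j + ?D k)) (9 * N)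
      = (case x of (p1, p2, p3) \<Rightarrow> if tsum p1 + tsum p2 + tsum p3 = 0
          then fps_X ^ twt p1 * fps_X ^ twt p2 * fps_X ^ twt p3 else (0 :: 'a fps))"
      unfolding x_eq prod.case coeff_monom by (simp only:)
  qed
  also have "\<dots> = (\<Sum>x\<in>?J \<times> ?J \<times> ?J. if x \<in> ?S then fps_const
      1 * fps_X ^ ?W x else 0)"
  proof (rule sum.cong[OF refl])
    fix x
    show "(case x of (p1, p2, p3) \<Rightarrow> if tsum p1 + tsum p2 + tsum p3 = 0
        then fps_X ^ twt p1 * fps_X ^ twt p2 * fps_X ^ twt p3 else 0)
      = (if x \<in> ?S then fps_const 1 * fps_X ^ ?W x else (0 :: 'a fps))"
      by (cases x) (simp only: prod.case mem_Collect_eq fps_const_1_eq_1 mult_1 power_add)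
  qed
  also have "\<dots> = (\<Sum>x\<in>{x \<in> ?J \<times> ?J \<times> ?J. x \<in> ?S}. fps_const
      1 * fps_X ^ ?W x)"
    by (rule sum.inter_filter[symmetric]) (intro finite_cartesian_product finite_atLeastAtMost_int)
  finally have eq: "coeff (?T ^ 9) (9 * N)
    = (\<Sum>x\<in>{x \<in> ?J \<times> ?J \<times> ?J. x \<in> ?S}. fps_const 1 * fps_X ^ ?W x)" .
  show ?thesis
    unfolding eq
  proof (rule gf_truncate)
    fix x assume x: "x \<in> ?S - {x \<in> ?J \<times> ?J \<times> ?J. x \<in> ?S}"
    obtain p1 p2 p3 where x_eq [simp]: "x = (p1, p2, p3)" by (cases x)
    have out: "N \<le> twt p" if "p \<notin> ?J" for p
    proof -
      obtain a b c where [simp]: "p = (a, b, c)" by (cases p)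
      from that have "a \<notin> ?I \<or> b \<notin> ?I \<or> c \<notin> ?I" by auto
      then have "N \<le> tri a \<or> N \<le> tri b \<or> N \<le> tri c"
        using tri_ge_outside[OF assms] by blast
      then show ?thesis by auto
    qed
    from x have "p1 \<notin> ?J \<or> p2 \<notin> ?J \<or> p3 \<notin> ?J" unfolding x_eq by blast
    then have "N \<le> twt p1 \<or> N \<le> twt p2 \<or> N \<le> twt p3" using out by blast
    then show "N \<le> ?W x" unfolding x_eq prod.case by linarith
  qed auto
qed

lemma cphi_9_gf:
  "Abs_fps (\<lambda>n. of_nat (cphi 9 n)) = partition_gf ^ 9 *
    gf {(p1, p2, p3). tsum p1 + tsum p2 + tsum p3 = 0} (\<lambda>(p1, p2, p3). twt p1 + twt p2 + twt p3)
      (\<lambda>_. 1 :: 'a::idom)" (is "?F = _ * ?G")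
proof (rule congr_fps_eqI)
  fix M :: nat assume "M > 0"
  define N where "N = 3 * M"
  have N: "N > 0" using \<open>M > 0\<close> by (simp add: N_def)
  have "congr (fps_X ^ N) ?F (coeff (trunc_prod (1::'a fps) N ^ 9) (9 * N))"
    unfolding fps_congr_X_iff by (simp add: cphi_eq_coeff)
  also have "congr (fps_X ^ N) (coeff (trunc_prod (1::'a fps) N ^ 9) (9 * N))
      (coeff (([:partition_gf:] * trunc_theta (\<lambda>_. 1) N) ^ 9) (9 * N))"
    using trunc_prod_congr[OF N, of "1::'a fps"]
    by (intro congr_poly_coeff congr_power) simp
  also have "coeff (([:partition_gf:] * trunc_theta (\<lambda>_. 1) N) ^ 9) (9 * N)
      = partition_gf ^ 9 * coeff (trunc_theta (\<lambda>_. 1 :: 'a fps) N ^ 9) (9 * N)"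
    by (simp only: power_mult_distrib const_poly_power) simp
  also have "congr (fps_X ^ N) \<dots> (partition_gf ^ 9 * ?G)"
    by (rule congr_mult_left[OF trunc_theta9_coeff[OF N]])
  finally show "congr (fps_X ^ (3 * M)) ?F (partition_gf ^ 9 * ?G)"
    by (simp add: N_def)
qed

section \<open>The hexagonal theta series and its 3-dissection\<close>

definition hex_A :: "'a::comm_ring_1 fps" where
  "hex_A = gf (row 0) twt (\<lambda>_. 1)"

text \<open>In terms of the Borwein cubic theta functions, \<open>hex_A\<close> is a(q), and this is
  c(q) with its factor \<open>q ^ (1/3)\<close> removed.\<close>

definition hex_C :: "'a::comm_ring_1 fps" where
  "hex_C = gf (row (- 1)) twt (\<lambda>_. 1)"

fun bc_diff :: "int3 \<Rightarrow> int" where "bc_diff (a, b, c) = b - c"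

lemma twt_eqI: "2 * int m = 2 * int n \<Longrightarrow> m = n"
  by simp

text \<open>The map \<open>(a, b, c) \<mapsto> (a - b, b - c, c - a)\<close> is the identity minus a
  rotation of order 3. It triples the norm, and its image is the index 3 sublattice
  \<open>b \<equiv> c\<close> modulo 3.\<close>

lemma hex_class_0: "gf {p \<in> row 0. bc_diff p mod 3 = 0} twt (\<lambda>_. 1) = dil (hex_A ::
    'a::idom fps)"
  unfolding hex_A_def dil_gf
proof (rule gf_reindex[where g = "\<lambda>(a, b, c). (a - b, b - c, c - a)" and
      h = "\<lambda>(a, b, c). (- b - 2 * ((c - b) div 3), b + (c - b) div 3, (c - b) div 3)"])
  fix p :: int3 assume p: "p \<in> {p \<in> row 0. bc_diff p mod 3 = 0}"
  obtain a b c where p_eq: "p = (a, b, c)" by (cases p)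
  define k where "k = (c - b) div 3"
  have k: "c = b + 3 * k" "a = - 2 * b - 3 * k"
    using p unfolding p_eq k_def by (simp_all, presburger+)
  show "(case case p of (a, b, c) \<Rightarrow> (- b - 2 * ((c - b) div 3), b + (c - b) div 3, (c
      - b) div 3) of
      (a, b, c) \<Rightarrow> (a - b, b - c, c - a)) = p"
    unfolding p_eq k by simp
  show "(case p of (a, b, c) \<Rightarrow> (- b - 2 * ((c - b) div 3), b + (c - b) div 3, (c - b)
      div 3)) \<in> row 0"
    unfolding p_eq by simp
next
  fix p :: int3 assume p: "p \<in> row 0"
  obtain a b c where p_eq: "p = (a, b, c)" by (cases p)
  have a: "a = - b - c" using p by (simp add: p_eq)
  show "(case case p of (a, b, c) \<Rightarrow> (a - b, b - c, c - a) of (a, b, c) \<Rightarrow>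
      (- b - 2 * ((c - b) div 3), b + (c - b) div 3, (c - b) div 3)) = p"
    unfolding p_eq a by simp
  show "(case p of (a, b, c) \<Rightarrow> (a - b, b - c, c - a)) \<in> {p \<in> row 0. bc_diff p
      mod 3 = 0}"
    unfolding p_eq a by simp
  show "twt (case p of (a, b, c) \<Rightarrow> (a - b, b - c, c - a)) = 3 * twt p"
    unfolding p_eq a prod.case
    using two_twt[of "- b - c - b" "b - c" "c - (- b - c)"] two_twt[of "- b - c" b c]
    by (intro twt_eqI) (simp add: algebra_simps del: twt.simps)
qed simp

text \<open>The same map carries \<open>row (- 1)\<close> onto a coset of that sublattice: the image
  has \<open>bc_diff\<close> equal to \<open>- 1 - 3 * c\<close>.\<close>

lemma hex_class_2: "gf {p \<in> row 0. bc_diff p mod 3 = 2} twt (\<lambda>_. 1) = fps_X * dil (hex_C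
    :: 'a::idom fps)"
proof -
  have "fps_X * dil (hex_C :: 'a::idom fps) = gf (row (- 1)) (\<lambda>p. 3 * twt p + 1) (\<lambda>_. 1)"
    unfolding hex_C_def dil_gf using gf_shift[of 1] by simp
  moreover have "gf {p \<in> row 0. bc_diff p mod 3 = 2} twt (\<lambda>_. 1) = gf (row (- 1))
      (\<lambda>p. 3 * twt p + 1) (\<lambda>_. 1 :: 'a)"
  proof (rule gf_reindex[where g = "\<lambda>(a, b, c). (a - b, b - c, c - a)" and
        h = "\<lambda>(a, b, c). (- 1 - b - 2 * ((c - b) div 3), b + (c - b) div 3, (c - b) div 3)"])
    fix p :: int3 assume p: "p \<in> {p \<in> row 0. bc_diff p mod 3 = 2}"
    obtain a b c where p_eq: "p = (a, b, c)" by (cases p)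
    define k where "k = (c - b) div 3"
    have k: "c = b + 3 * k + 1" "a = - 2 * b - 3 * k - 1"
      using p unfolding p_eq k_def by (simp_all, presburger+)
    show "(case case p of (a, b, c) \<Rightarrow> (- 1 - b - 2 * ((c - b) div 3), b + (c - b)
        div 3, (c - b) div 3) of
        (a, b, c) \<Rightarrow> (a - b, b - c, c - a)) = p"
      unfolding p_eq k by simp
    show "(case p of (a, b, c) \<Rightarrow> (- 1 - b - 2 * ((c - b) div 3), b + (c - b) div 3,
        (c - b) div 3)) \<in> row (- 1)"
      unfolding p_eq by simp
  next
    fix p :: int3 assume p: "p \<in> row (- 1)"
    obtain a b c where p_eq: "p = (a, b, c)" by (cases p)
    have a: "a = - 1 - b - c" using p by (simp add: p_eq)
    show "(case case p of (a, b, c) \<Rightarrow> (a - b, b - c, c - a) of (a, b, c) \<Rightarrow>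
        (- 1 - b - 2 * ((c - b) div 3), b + (c - b) div 3, (c - b) div 3)) = p"
      unfolding p_eq a by simp
    show "(case p of (a, b, c) \<Rightarrow> (a - b, b - c, c - a)) \<in> {p \<in> row 0.
        bc_diff p mod 3 = 2}"
      unfolding p_eq a by simp presburger
    show "twt (case p of (a, b, c) \<Rightarrow> (a - b, b - c, c - a)) = 3 * twt p + 1"
      unfolding p_eq a prod.case
      using two_twt[of "- 1 - b - c - b" "b - c" "c - (- 1 - b - c)"] two_twt[of "- 1 - b - c" b c]
      by (intro twt_eqI) (simp add: algebra_simps del: twt.simps)
  qed simp
  ultimately show ?thesis by simp
qed

lemma hex_class_1:
  "gf {p \<in> row 0. bc_diff p mod 3 = 1} twt (\<lambda>_. 1) = fps_X * dil (hex_C :: 'a::idom fps)"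
proof -
  have "gf {p \<in> row 0. bc_diff p mod 3 = 1} twt (\<lambda>_. 1) = gf {p \<in> row 0. bc_diff p
      mod 3 = 2} twt (\<lambda>_. 1 :: 'a)"
    by (rule gf_reindex[where g = "\<lambda>(a, b, c). (a, c, b)" and h = "\<lambda>(a, b, c).
        (a, c, b)"])
       (auto, presburger+)
  then show ?thesis by (simp add: hex_class_2)
qed

lemma hex_partition:
  "gf (row 0) twt c = (\<Sum>r\<in>{0, 1, 2}. gf {p \<in> row 0. bc_diff p mod 3 = r} twt c)"
  by (rule gf_partition[OF finite_fibres_twt]) auto

lemma hex_A_dissection: "hex_A = dil hex_A + 2 * fps_X * dil (hex_C :: 'a::idom fps)"
  using hex_partition[of "\<lambda>_. 1 :: 'a"]
  by (simp add: hex_class_0 hex_class_1 hex_class_2 hex_A_def[symmetric] mult.assoc)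

text \<open>The power \<open>\<omega> ^ m\<close> for an integer exponent, read off from its residue
  so that no inverse of \<open>\<omega>\<close> occurs.\<close>

definition cubic_char :: "'a::comm_ring_1 \<Rightarrow> int \<Rightarrow> 'a" where
  "cubic_char \<omega> m = (if m mod 3 = 0 then 1 else if m mod 3 = 1 then \<omega> else \<omega> ^ 2)"

lemma power_eq_cubic_char:
  assumes "\<omega> ^ 3 = 1"
  shows "\<omega> ^ k = cubic_char \<omega> (int k)"
proof -
  have "\<omega> ^ k = (\<omega> ^ 3) ^ (k div 3) * \<omega> ^ (k mod 3)"
    by (metis mult_div_mod_eq power_add power_mult)
  also have "\<dots> = \<omega> ^ (k mod 3)" by (simp add: assms)
  also have "\<dots> = cubic_char \<omega> (int k)"
  proof -
    have "k mod 3 = 0 \<or> k mod 3 = 1 \<or> k mod 3 = 2" by presburger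
    moreover have "int k mod 3 = int (k mod 3)" by (simp add: zmod_int)
    ultimately show ?thesis by (auto simp: cubic_char_def)
  qed
  finally show ?thesis .
qed

lemma cubic_factor_1:
  fixes W x :: "'a::idom"
  assumes "1 + W + W ^ 2 = 0"
  shows "(1 + x) * (1 + W * x) * (1 + W ^ 2 * x) = 1 + x ^ 3"
  using assms by algebra

lemma cubic_factor_2:
  fixes W x :: "'a::idom"
  assumes "1 + W + W ^ 2 = 0"
  shows "(P + x) * (P + W * x) * (P + W ^ 2 * x) = P ^ 3 + x ^ 3"
  using assms by algebra

text \<open>Factor by factor, multiplying over \<open>z\<close>, \<open>\<omega> z\<close>,
  \<open>\<omega> ^ 2 z\<close> cubes both terms, which leaves the same truncated product in
  \<open>z ^ 3\<close> and \<open>q ^ 3\<close>.\<close>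

lemma trunc_prod_cubic:
  fixes \<omega> :: "'a::idom"
  assumes "1 + \<omega> + \<omega> ^ 2 = 0"
  shows "trunc_prod 1 N * trunc_prod (fps_const \<omega>) N * trunc_prod (fps_const \<omega> ^ 2) N
    = (\<Prod>i<N. (1 + monom 1 3 * [:fps_X ^ 3:] ^ Suc i) * ([:fps_X ^ 3:] ^ i + monom 1 3))"
proof -
  let ?z = "monom (1 :: 'a fps) 1"
  let ?W = "[:fps_const \<omega>:]"
  have "fps_const 1 + fps_const \<omega> + fps_const (\<omega> ^ 2) = fps_const 0"
    unfolding fps_const_add assms ..
  then have W: "1 + ?W + ?W ^ 2 = 0"
    by (simp add: const_poly_power one_pCons fps_const_power)
  have m: "monom (fps_const \<omega>) 1 = ?W * ?z" "monom (fps_const \<omega> ^ 2) 1 = ?W ^ 2 * ?z"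
    by (simp_all add: const_poly_power smult_monom)
  have z: "monom 1 3 = ?z ^ 3" by (simp add: monom_power)
  have X: "[:fps_X ^ 3:] ^ k = ([:fps_X:] ^ k) ^ 3" for k
    by (simp add: const_poly_power power_mult[symmetric] mult.commute)
  show ?thesis
    unfolding trunc_prod_def prod.distrib[symmetric]
  proof (rule prod.cong[OF refl])
    fix i
    let ?Q = "[:fps_X:] ^ Suc i :: 'a fps poly" and ?P = "[:fps_X:] ^ i :: 'a fps poly"
    have "(1 + ?z * ?Q) * (?P + ?z) * ((1 + ?W * ?z * ?Q) * (?P + ?W * ?z)) * ((1 +
        ?W ^ 2 * ?z * ?Q) * (?P + ?W ^ 2 * ?z))
      = ((1 + ?z * ?Q) * (1 + ?W * (?z * ?Q)) * (1 + ?W ^ 2 * (?z * ?Q))) * ((?P + ?z) * (?P +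
          ?W * ?z) * (?P + ?W ^ 2 * ?z))"
      by (simp only: mult_ac)
    also have "\<dots> = (1 + (?z * ?Q) ^ 3) * (?P ^ 3 + ?z ^ 3)"
      by (simp only: cubic_factor_1[OF W] cubic_factor_2[OF W] power_one)
    also have "\<dots> = (1 + ?z ^ 3 * ?Q ^ 3) * (?P ^ 3 + ?z ^ 3)"
      by (simp only: power_mult_distrib)
    finally show "(1 + ?z * ?Q) * (?P + ?z) * ((1 + monom (fps_const \<omega>) 1 * ?Q) * (?P +
        monom (fps_const \<omega>) 1))
        * ((1 + monom (fps_const \<omega> ^ 2) 1 * ?Q) * (?P + monom (fps_const \<omega> ^ 2) 1))
      = (1 + monom 1 3 * [:fps_X ^ 3:] ^ Suc i) * ([:fps_X ^ 3:] ^ i + monom 1 3)"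
      unfolding m z X .
  qed
qed

lemma cubic_root_gf:
  fixes \<omega> :: "'a::idom"
  assumes \<omega>: "1 + \<omega> + \<omega> ^ 2 = 0"
  shows "partition_gf ^ 3 * gf (row 0) twt (\<lambda>(a, b, c). 1 * cubic_char \<omega>
      b * cubic_char \<omega> (2 * c)) = dil partition_gf"
    (is "_ * ?G = _")
proof (rule congr_fps_eqI)
  fix M :: nat assume "M > 0"
  define N where "N = 3 * M"
  have N: "N > 0" using \<open>M > 0\<close> by (simp add: N_def)
  let ?d = "fps_X ^ N :: 'a fps"
  have \<omega>3: "\<omega> ^ 3 = 1" using \<omega> by algebra
  have theta: "trunc_theta (\<lambda>a. fps_const \<omega> ^ nat (a + int N)) N = trunc_theta
      (\<lambda>a. fps_const (cubic_char \<omega> a)) N"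
    "trunc_theta (\<lambda>a. (fps_const \<omega> ^ 2) ^ nat (a + int N)) N = trunc_theta
        (\<lambda>a. fps_const (cubic_char \<omega> (2 * a))) N"
  proof -
    have "fps_const \<omega> ^ nat (a + int N) = fps_const (cubic_char \<omega> a)"
      "(fps_const \<omega> ^ 2) ^ nat (a + int N) = fps_const (cubic_char \<omega> (2 * a))"
      if "a \<in> {- int N..int N}" for a
    proof -
      have "\<omega> ^ nat (a + int N) = cubic_char \<omega> a"
        using that by (simp add: power_eq_cubic_char[OF \<omega>3]) (simp add: cubic_char_def N_def)
      moreover have "\<omega> ^ (2 * nat (a + int N)) = cubic_char \<omega> (2 * a)"
      proof -
        have "int (2 * nat (a + int N)) = 2 * a + 3 * (2 * int M)"
          using that by (simp add: N_def)
        then have "int (2 * nat (a + int N)) mod 3 = (2 * a) mod 3" by (metis mod_mult_self2)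
        then have "cubic_char \<omega> (int (2 * nat (a + int N))) = cubic_char \<omega> (2 * a)"
          by (simp only: cubic_char_def)
        then show ?thesis by (simp only: power_eq_cubic_char[OF \<omega>3, of "2 * nat (a + int N)"])
      qed
      ultimately show "fps_const \<omega> ^ nat (a + int N) = fps_const (cubic_char \<omega> a)"
        "(fps_const \<omega> ^ 2) ^ nat (a + int N) = fps_const (cubic_char \<omega> (2 * a))"
        by (simp_all add: fps_const_power flip: power_mult)
    qed
    then show "trunc_theta (\<lambda>a. fps_const \<omega> ^ nat (a + int N)) N = trunc_theta
        (\<lambda>a. fps_const (cubic_char \<omega> a)) N"
      "trunc_theta (\<lambda>a. (fps_const \<omega> ^ 2) ^ nat (a + int N)) N = trunc_theta
          (\<lambda>a. fps_const (cubic_char \<omega> (2 * a))) N"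
      unfolding trunc_theta_def by (auto intro!: sum.cong)
  qed
  define T1 where "T1 = trunc_theta (\<lambda>a. fps_const (1::'a)) N"
  define T2 where "T2 = trunc_theta (\<lambda>a. fps_const (cubic_char \<omega> a)) N"
  define T3 where "T3 = trunc_theta (\<lambda>a. fps_const (cubic_char \<omega> (2 * a))) N"
  have c1: "congr [:?d:] (trunc_prod 1 N) ([:partition_gf:] * T1)"
    using trunc_prod_congr[OF N, of "1 :: 'a fps"] by (simp add: T1_def)
  have c2: "congr [:?d:] (trunc_prod (fps_const \<omega>) N) ([:partition_gf:] * T2)"
    using trunc_prod_congr[OF N, of "fps_const \<omega>"] by (simp only: theta T2_def)
  have c3: "congr [:?d:] (trunc_prod (fps_const \<omega> ^ 2) N) ([:partition_gf:] * T3)"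
    using trunc_prod_congr[OF N, of "fps_const \<omega> ^ 2"] by (simp only: theta T3_def)
  have e0: "congr ?d (coeff (trunc_prod 1 N * trunc_prod (fps_const \<omega>) N * trunc_prod
      (fps_const \<omega> ^ 2) N) (3 * N))
    (coeff ([:partition_gf:] * T1 * ([:partition_gf:] * T2) * ([:partition_gf:] * T3)) (3 * N))"
    by (intro congr_poly_coeff congr_mult c1 c2 c3)
  have e1: "[:partition_gf:] * T1 * ([:partition_gf:] * T2) * ([:partition_gf:] * T3) =
      [:partition_gf ^ 3:] * (T1 * T2 * T3)"
    unfolding const_poly_power[symmetric] by (simp only: power3_eq_cube mult_ac)
  have e2: "coeff ([:partition_gf ^ 3:] * (T1 * T2 * T3)) (3 * N) = partition_gf ^ 3 * coeff
      (T1 * T2 * T3) (3 * N)"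
    by simp
  have e3: "congr ?d (partition_gf ^ 3 * coeff (T1 * T2 * T3) (3 * N)) (partition_gf ^ 3 * ?G)"
    unfolding T1_def T2_def T3_def by (rule congr_mult_left[OF trunc_theta3_coeff[OF N]])
  have A: "congr ?d (coeff (trunc_prod 1 N * trunc_prod (fps_const \<omega>) N * trunc_prod
      (fps_const \<omega> ^ 2) N) (3 * N))
      (partition_gf ^ 3 * ?G)"
    by (rule congr_trans[OF e0[unfolded e1 e2] e3])
  \<comment> \<open>The second evaluation: in the expansion by powers of \<open>z ^ 3\<close> only
    \<open>k = N\<close> meets degree \<open>3 * N\<close>, where \<open>tri 0 = 0\<close> leaves
    the central Gaussian binomial in \<open>q ^ 3\<close>.\<close>
  have "(\<Prod>i<N. (1 + monom 1 3 * [:fps_X ^ 3:] ^ Suc i) * ([:fps_X ^ 3:] ^ i + monom (1 :: 'a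
      fps) 3))
    = (\<Sum>k\<le>2 * N. qbin [:fps_X ^ 3:] (2 * N) k * [:fps_X ^ 3:] ^ tri (int k - int
        N) * monom 1 3 ^ k)"
    by (rule finite_triple_product) (use N in auto)
  also have "\<dots> = (\<Sum>k\<le>2 * N. monom (qbin (fps_X ^ 3) (2 * N) k * (fps_X ^ 3) ^ tri
      (int k - int N)) (3 * k))"
    by (simp add: qbin_const_poly const_poly_power monom_power smult_monom mult.commute)
  finally have "coeff (trunc_prod 1 N * trunc_prod (fps_const \<omega>) N * trunc_prod (fps_const
      \<omega> ^ 2) N) (3 * N)
    = (\<Sum>k\<le>2 * N. if k = N then qbin (fps_X ^ 3) (2 * N) k * (fps_X ^ 3) ^ tri (int k -
        int N) else 0)"
    unfolding trunc_prod_cubic[OF \<omega>] by (simp add: coeff_sum coeff_monom cong: if_cong)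
  also have "\<dots> = dil (qbin fps_X (2 * N) N)"
    by (simp add: tri_def dil_qbin)
  finally have B: "coeff (trunc_prod 1 N * trunc_prod (fps_const \<omega>) N * trunc_prod
      (fps_const \<omega> ^ 2) N) (3 * N)
    = dil (qbin fps_X (2 * N) N)" .
  have C: "congr ?d (dil (qbin fps_X (2 * N) N)) (dil partition_gf)"
    by (intro dil_congr congr_X_power_mono[OF _ qbin_X_congr[of N _ N]]) auto
  show "congr (fps_X ^ (3 * M)) (partition_gf ^ 3 * ?G) (dil partition_gf)"
    unfolding N_def[symmetric] by (rule congr_trans[OF congr_sym[OF A[unfolded B]] C])
qed

text \<open>Since \<open>b + 2 c \<equiv> b - c\<close> modulo 3, the weight is constant on the
  classes of \<open>bc_diff\<close>. Classes 1 and 2 have the same series, and their weights add up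
  to \<open>\<omega> + \<omega> ^ 2 = - 1\<close>.\<close>

lemma cubic_gf_eval:
  fixes \<omega> :: "'a::idom"
  assumes \<omega>: "1 + \<omega> + \<omega> ^ 2 = 0"
  shows "gf (row 0) twt (\<lambda>(a, b, c). 1 * cubic_char \<omega> b * cubic_char \<omega>
      (2 * c)) = dil hex_A - fps_X * dil hex_C"
proof -
  have \<omega>3: "\<omega> ^ 3 = 1" using \<omega> by algebra
  have pw1: "\<omega> * \<omega> = \<omega> ^ 2" by (simp add: power2_eq_square)
  have pw2: "\<omega> * \<omega> ^ 2 = 1" using \<omega>3 by algebra
  have pw3: "\<omega> ^ 2 * \<omega> = 1" using \<omega>3 by algebra
  have pw4: "\<omega> ^ 2 * \<omega> ^ 2 = \<omega>" using \<omega>3 by algebra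
  have pw5: "\<omega> ^ 4 = \<omega>" using \<omega>3 by algebra
  note pw = pw1 pw2 pw3 pw4 pw5
  have char: "1 * cubic_char \<omega> b * cubic_char \<omega> (2 * c) = cubic_char \<omega> (b -
      c)" for b c
  proof -
    have "b mod 3 = 0 \<or> b mod 3 = 1 \<or> b mod 3 = 2" "c mod 3 = 0 \<or> c mod 3 = 1 \<or>
        c mod 3 = 2"
      by presburger+
    moreover have "(b - c) mod 3 = (b mod 3 - c mod 3) mod 3" "(2 * c) mod 3 = (2 * (c mod 3)) mod 3"
      by (simp_all add: mod_diff_eq mod_mult_right_eq)
    ultimately show ?thesis
      unfolding cubic_char_def by (elim disjE) (simp_all add: pw)
  qed
  have cls: "gf {p \<in> row 0. bc_diff p mod 3 = r} twt (\<lambda>(a, b, c). cubic_char \<omega>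
      (b - c))
      = fps_const (cubic_char \<omega> r) * gf {p \<in> row 0. bc_diff p mod 3 = r} twt
          (\<lambda>_. 1)" for r
    unfolding gf_scale[symmetric] by (rule gf_cong) (auto simp: cubic_char_def)
  have sum: "fps_const \<omega> + fps_const (\<omega> ^ 2) = fps_const (- 1)"
    unfolding fps_const_add using \<omega> by (metis add.assoc add.commute add_eq_0_iff)
  have s: "fps_const \<omega> * F + fps_const (\<omega> ^ 2) * F = - F" for F :: "'a fps"
    unfolding distrib_right[symmetric] sum by (rule fps_ext) simp
  show ?thesis
    unfolding char hex_partition cls
    by (simp add: hex_class_0 hex_class_1 hex_class_2 cubic_char_def s)
qed

text \<open>The integers have no primitive cube root of unity; identities between integer series are
  proved over the complex numbers and pulled back along this embedding.\<close>

definition fps_of_int :: "int fps \<Rightarrow> 'a::comm_ring_1 fps" where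
  "fps_of_int F = Abs_fps (\<lambda>n. of_int (F $ n))"

lemma fps_of_int_mult: "fps_of_int (F * G) = fps_of_int F * fps_of_int G"
  by (rule fps_ext) (simp add: fps_of_int_def fps_mult_nth)

lemma fps_of_int_diff: "fps_of_int (F - G) = fps_of_int F - fps_of_int G"
  by (rule fps_ext) (simp add: fps_of_int_def)

lemma fps_of_int_1: "fps_of_int 1 = 1"
  by (rule fps_ext) (simp add: fps_of_int_def fps_one_nth)

lemma fps_of_int_X: "fps_of_int fps_X = fps_X"
  by (rule fps_ext) (simp add: fps_of_int_def fps_X_def)

lemma fps_of_int_power: "fps_of_int (F ^ n) = fps_of_int F ^ n"
  by (induction n) (auto simp: fps_of_int_mult fps_of_int_1)

lemma fps_of_int_dil: "fps_of_int (dil F) = dil (fps_of_int F)"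
  by (rule fps_ext) (simp add: fps_of_int_def dil_nth)

lemma fps_of_int_gf: "fps_of_int (gf I w (\<lambda>_. 1)) = gf I w (\<lambda>_. 1)"
  by (rule fps_ext) (simp add: fps_of_int_def gf_nth)

lemma fps_of_int_qpoch: "fps_of_int (qpoch q n) = qpoch (fps_of_int q) n"
  by (induction n) (auto simp: qpoch_Suc fps_of_int_mult fps_of_int_diff fps_of_int_1 fps_of_int_power)

lemma fps_of_int_euler: "fps_of_int euler = (euler :: 'a::comm_ring_1 fps)"
proof (rule fps_ext)
  fix n
  have "fps_of_int (qpoch fps_X n) $ n = (qpoch fps_X n :: 'a fps) $ n"
    by (simp add: fps_of_int_qpoch fps_of_int_X)
  then show "fps_of_int euler $ n = (euler :: 'a fps) $ n"
    by (simp add: fps_of_int_def euler_def)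
qed

lemma fps_of_int_inject:
  assumes "fps_of_int F = (fps_of_int G :: complex fps)"
  shows "F = G"
proof (rule fps_ext)
  fix n
  show "F $ n = G $ n"
    using fps_eq_iff[THEN iffD1, OF assms, rule_format, of n] by (simp add: fps_of_int_def)
qed

text \<open>
  The constant term in \<open>z\<close> of the product of the triple products at \<open>z\<close>,
      \<open>\<omega> z\<close>, \<open>\<omega>\<^sup>2 z\<close>, for a
  primitive cube root of unity \<open>\<omega>\<close>, is computed in two ways.
\<close>

lemma hex_B_product:
  "(dil hex_A - fps_X * dil hex_C) * dil euler = (euler ^ 3 :: int fps)"
proof (rule fps_of_int_inject)
  define \<omega> where "\<omega> = Complex (- 1 / 2) (sqrt 3 / 2)"
  have \<omega>: "1 + \<omega> + \<omega> ^ 2 = 0"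
    by (simp add: \<omega>_def complex_eq_iff power2_eq_square)
  have gf: "partition_gf ^ 3 * (dil hex_A - fps_X * dil hex_C) = dil (partition_gf :: complex fps)"
    using cubic_root_gf[OF \<omega>] unfolding cubic_gf_eval[OF \<omega>] .
  have "euler ^ 3 * partition_gf ^ 3 = (1 :: complex fps)"
    by (metis euler_partition_gf power_mult_distrib power_one)
  moreover have "dil euler * dil partition_gf = (1 :: complex fps)"
    by (metis euler_partition_gf dil_mult dil_1)
  moreover have "B * E = e" if "e * f = 1" "E * F = 1" "f * B = F" for e f E F B :: "complex fps"
    using that by algebra
  ultimately have "(dil hex_A - fps_X * dil hex_C) * dil euler = (euler ^ 3 :: complex fps)"
    using gf by blast
  then show "fps_of_int ((dil hex_A - fps_X * dil hex_C) * dil euler) = (fps_of_int (euler ^ 3) ::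
      complex fps)"
    by (simp add: fps_of_int_mult fps_of_int_diff fps_of_int_power fps_of_int_dil fps_of_int_euler
        fps_of_int_X fps_of_int_gf hex_A_def hex_C_def)
qed

subsection \<open>Jacobi's identity and product formulas\<close>

definition alt_sign :: "int \<Rightarrow> int" where
  "alt_sign m = (if even m then 1 else - 1)"

lemma tri_reflect: "tri (- 1 - m) = tri m"
  unfolding tri_def by (rule arg_cong[where f = nat]) (simp add: algebra_simps)

text \<open>The reflection \<open>m \<mapsto> - 1 - m\<close> preserves \<open>tri\<close> and
  reverses the sign.\<close>

lemma gf_alt_sign: "gf UNIV tri alt_sign = 0"
proof -
  have "gf UNIV tri alt_sign = gf UNIV tri (\<lambda>m. - 1 * alt_sign m)"
    by (rule gf_reindex[where g = "\<lambda>m. - 1 - m" and h = "\<lambda>m. - 1 - m"])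
       (auto simp: tri_reflect alt_sign_def)
  also have "\<dots> = fps_const (- 1) * gf UNIV tri alt_sign"
    by (rule gf_scale)
  finally have "gf UNIV tri alt_sign $ n = - (gf UNIV tri alt_sign $ n)" for n
    by (metis fps_mult_left_const_nth mult_minus1)
  then show ?thesis by (intro fps_ext) (simp add: equal_neg_zero)
qed

lemma pderiv_sum: "pderiv (sum p I) = (\<Sum>i\<in>I. pderiv (p i))"
  by (induction I rule: infinite_finite_induct) (auto simp: pderiv_add)

lemma congr_poly_pderiv:
  assumes "congr [:d:] p q"
  shows "congr d (poly (pderiv p) x) (poly (pderiv q) x :: 'a::idom)"
proof -
  obtain r where "p - q = [:d:] * r" using assms by (auto simp: congr_def dvd_def)
  then have "pderiv (p - q) = pderiv (smult d r)" by simp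
  then have "pderiv p - pderiv q = smult d (pderiv r)" by (simp add: pderiv_diff pderiv_smult)
  then have "poly (pderiv p) x - poly (pderiv q) x = d * poly (pderiv r) x"
    by (metis poly_diff poly_smult)
  then show ?thesis by (simp add: congr_def)
qed

text \<open>Pairing \<open>m\<close> with \<open>- 1 - m\<close> gives the familiar sum of
  \<open>(- 1) ^ m * (2 * m + 1) * q ^ tri m\<close> over \<open>m \<ge> 0\<close>.\<close>

definition jacobi_series :: "int fps" where
  "jacobi_series = gf UNIV tri (\<lambda>m. alt_sign m * m)"

text \<open>The factor \<open>1 + z\<close> vanishes at \<open>z = - 1\<close>, so the derivative
  there is the value of the remaining factors.\<close>

lemma trunc_prod_pderiv:
  "poly (pderiv (trunc_prod (1 :: 'a::idom fps) (Suc M))) (- 1) = (- 1) ^ M * (qpoch fps_X (Suc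
      M) * qpoch fps_X M)"
proof -
  let ?z = "monom (1 :: 'a fps) 1"
  define G where "G = (\<Prod>i<Suc M. 1 + ?z * [:fps_X:] ^ Suc i) * (\<Prod>i<M. [:fps_X:] ^ Suc
      i + ?z)"
  have "trunc_prod (1 :: 'a fps) (Suc M)
      = (\<Prod>i<Suc M. 1 + ?z * [:fps_X:] ^ Suc i) * (\<Prod>i<Suc M. [:fps_X:] ^ i + ?z)"
    by (simp add: trunc_prod_def prod.distrib)
  also have "(\<Prod>i<Suc M. [:fps_X:] ^ i + ?z) = (1 + ?z) * (\<Prod>i<M. [:fps_X:] ^ Suc i + ?z)"
    by (subst prod.lessThan_Suc_shift) simp
  finally have "trunc_prod (1 :: 'a fps) (Suc M) = (1 + ?z) * G"
    by (simp only: G_def mult_ac)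
  then have "poly (pderiv (trunc_prod (1 :: 'a fps) (Suc M))) (- 1) = poly G (- 1)"
    by (simp add: pderiv_mult pderiv_add pderiv_monom poly_monom)
  also have "\<dots> = (\<Prod>i<Suc M. 1 - fps_X ^ Suc i) * (\<Prod>i<M. - (1 - fps_X ^ Suc i))"
    unfolding G_def by (simp only: const_poly_power) (simp add: poly_prod poly_monom)
  also have "(\<Prod>i<M. - (1 - fps_X ^ Suc i)) = (- 1) ^ M * (qpoch fps_X M :: 'a fps)"
    by (subst prod_uminus) (simp add: qpoch_def)
  finally show ?thesis by (simp add: qpoch_def mult_ac)
qed

text \<open>Differentiation produces the shifted exponent \<open>a + Suc M\<close>. Splitting it
  isolates a multiple of the alternating sum, whose limit vanishes by
  \<open>gf_alt_sign\<close>.\<close>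

lemma trunc_theta_pderiv:
  "poly (pderiv (trunc_theta (\<lambda>_. 1 :: int fps) (Suc M))) (- 1) =
    (- 1) ^ M * ((\<Sum>a\<in>{- int (Suc M)..int (Suc M)}. fps_const (alt_sign a * a) * fps_X ^ tri a)
      + of_nat (Suc M) * (\<Sum>a\<in>{- int (Suc M)..int (Suc M)}. fps_const (alt_sign
          a) * fps_X ^ tri a))"
proof -
  let ?I = "{- int (Suc M)..int (Suc M)}"
  have sg: "fps_const (alt_sign a * a) + of_nat (Suc M) * fps_const (alt_sign a)
      = fps_const (alt_sign a * (a + int (Suc M)))" for a
    by (simp add: fps_of_nat[symmetric] algebra_simps del: of_nat_Suc)
  have "poly (pderiv (trunc_theta (\<lambda>_. 1 :: int fps) (Suc M))) (- 1)
    = (\<Sum>a\<in>?I. of_nat (nat (a + int (Suc M))) * fps_X ^ tri a * (- 1) ^ (nat (a + int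
        (Suc M)) - 1))"
    by (simp add: trunc_theta_def pderiv_sum pderiv_monom poly_sum poly_monom del: of_nat_Suc)
  also have "\<dots> = (\<Sum>a\<in>?I. (- 1) ^ M * (fps_const (alt_sign a * a) * fps_X ^ tri a
      + of_nat (Suc M) * (fps_const (alt_sign a) * fps_X ^ tri a)))"
  proof (rule sum.cong[OF refl])
    fix a assume a: "a \<in> ?I"
    define k where "k = nat (a + int (Suc M))"
    have k: "int k = a + int (Suc M)" using a by (simp add: k_def)
    have "(of_nat k :: int fps) * (- 1) ^ (k - 1) = fps_const ((- 1) ^ M * (alt_sign a * (a +
        int (Suc M))))"
    proof -
      \<comment> \<open>At \<open>k = 0\<close> the truncated exponent is harmless because of the
        factor \<open>k\<close>.\<close>
      have "int k * (- 1) ^ (k - 1) = (- 1) ^ M * (alt_sign a * int k)"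
      proof (cases k)
        case (Suc j)
        then have "a = int j - int M" using k by simp
        then show ?thesis using Suc by (auto simp: alt_sign_def minus_one_power_iff)
      qed simp
      then have "fps_const (int k * (- 1) ^ (k - 1)) = fps_const ((- 1) ^ M * (alt_sign a * int k))"
        by simp
      then show ?thesis
        unfolding k[symmetric]
        by (simp add: fps_of_nat[symmetric] fps_const_mult[symmetric]
            fps_const_power[symmetric] del: fps_const_mult fps_const_power)
    qed
    then show "of_nat (nat (a + int (Suc M))) * fps_X ^ tri a * (- 1) ^ (nat (a + int (Suc M)) - 1)
      = (- 1) ^ M * (fps_const (alt_sign a * a) * fps_X ^ tri a
        + of_nat (Suc M) * (fps_const (alt_sign a) * fps_X ^ tri a))"
      unfolding k_def[symmetric] mult.assoc[symmetric] distrib_right[symmetric] sg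
      by (simp add: fps_const_mult[symmetric] fps_const_power[symmetric] mult_ac del:
          fps_const_mult fps_const_power)
  qed
  also have "\<dots> = (- 1) ^ M * ((\<Sum>a\<in>?I. fps_const (alt_sign a * a) * fps_X ^ tri a)
      + of_nat (Suc M) * (\<Sum>a\<in>?I. fps_const (alt_sign a) * fps_X ^ tri a))"
    by (simp only: sum_distrib_left[symmetric] sum.distrib)
  finally show ?thesis .
qed

text \<open>The derivative of the triple product at \<open>z = - 1\<close> is, up to a common sign
  and truncation, \<open>euler ^ 2\<close> on one side and
  \<open>partition_gf * jacobi_series\<close> on the other; multiplication by \<open>euler\<close>
  finishes.\<close>

lemma jacobi_identity: "euler ^ 3 = jacobi_series"
proof (rule congr_fps_eqI)
  fix n :: nat assume n: "n > 0"
  define M where "M = 3 * n - 1"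
  have M: "3 * n = Suc M" using n by (simp add: M_def)
  let ?d = "fps_X ^ Suc M :: int fps"
  let ?I = "{- int (Suc M)..int (Suc M)}"
  let ?s = "(- 1) ^ M :: int fps"
  have out: "Suc M \<le> tri a" if "a \<in> UNIV - ?I" for a
    using that by (intro tri_ge_outside) auto
  have "congr ?d (?s * (qpoch fps_X (Suc M) * qpoch fps_X M))
      (poly (pderiv ([:partition_gf:] * trunc_theta (\<lambda>_. 1 :: int fps) (Suc M))) (- 1))"
    unfolding trunc_prod_pderiv[symmetric]
    using trunc_prod_congr[of "Suc M" "1 :: int fps"] by (intro congr_poly_pderiv) simp
  moreover have "poly (pderiv ([:partition_gf:] * trunc_theta (\<lambda>_. 1 :: int fps) (Suc M))) (- 1)
    = ?s * (partition_gf * ((\<Sum>a\<in>?I. fps_const (alt_sign a * a) * fps_X ^ tri a)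
      + of_nat (Suc M) * (\<Sum>a\<in>?I. fps_const (alt_sign a) * fps_X ^ tri a)))"
    using trunc_theta_pderiv[of M] by (simp add: pderiv_smult mult_ac del: of_nat_Suc)
  ultimately have "congr ?d (?s * (qpoch fps_X (Suc M) * qpoch fps_X M))
      (?s * (partition_gf * ((\<Sum>a\<in>?I. fps_const (alt_sign a * a) * fps_X ^ tri a)
      + of_nat (Suc M) * (\<Sum>a\<in>?I. fps_const (alt_sign a) * fps_X ^ tri a))))"
    by simp
  then have 1: "congr ?d (qpoch fps_X (Suc M) * qpoch fps_X M)
      (partition_gf * ((\<Sum>a\<in>?I. fps_const (alt_sign a * a) * fps_X ^ tri a)
      + of_nat (Suc M) * (\<Sum>a\<in>?I. fps_const (alt_sign a) * fps_X ^ tri a)))"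
    by (rule congr_unit_cancel[of ?s ?s, rotated]) (simp flip: power_mult_distrib)
  have 2: "congr ?d (euler * euler) (qpoch fps_X (Suc M) * qpoch fps_X M)"
  proof (rule congr_sym[OF congr_mult])
    show "congr ?d (qpoch fps_X (Suc M)) euler"
      by (rule congr_X_power_mono[OF _ qpoch_X_euler]) simp
    show "congr ?d (qpoch fps_X M) euler" by (rule qpoch_X_euler)
  qed
  have 3: "congr ?d (partition_gf * ((\<Sum>a\<in>?I. fps_const (alt_sign a * a) * fps_X ^ tri a)
      + of_nat (Suc M) * (\<Sum>a\<in>?I. fps_const (alt_sign a) * fps_X ^ tri a)))
    (partition_gf * (jacobi_series + of_nat (Suc M) * gf UNIV tri alt_sign))"
    unfolding jacobi_series_def
    by (intro congr_mult_left congr_add gf_truncate out) auto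
  have "congr ?d (euler * (euler * euler)) (euler * (partition_gf * (jacobi_series + of_nat (Suc
      M) * gf UNIV tri alt_sign)))"
    by (rule congr_mult_left[OF congr_trans[OF 2 congr_trans[OF 1 3]]])
  moreover have "euler * (partition_gf * (jacobi_series + of_nat (Suc M) * gf UNIV tri alt_sign))
      = jacobi_series"
    by (simp add: gf_alt_sign mult.assoc[symmetric] euler_partition_gf)
  ultimately show "congr (fps_X ^ (3 * n)) (euler ^ 3) jacobi_series"
    unfolding M by (simp add: power3_eq_cube mult.assoc)
qed

lemma sect_diff: "sect r (F - G) = sect r F - sect r (G :: 'a::comm_ring_1 fps)"
  by (rule fps_ext) (simp add: sect_def)

text \<open>The exponent \<open>tri m\<close> is 1 modulo 3 exactly for \<open>m = 3 k + 1\<close>,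
  and then equals \<open>9 * tri k + 1\<close>. The coefficient splits into \<open>- 3\<close> times
  that of \<open>k\<close> and an alternating part with sum zero.\<close>

lemma sect_jacobi: "sect 1 jacobi_series = - 3 * dil jacobi_series"
proof -
  have "sect 1 jacobi_series = gf {m. tri m mod 3 = 1} (\<lambda>m. tri m div 3) (\<lambda>m.
      alt_sign m * m)"
    unfolding jacobi_series_def
    by (rule fps_ext) (auto simp: sect_def gf_nth intro!: sum.cong, presburger)
  also have "\<dots> = gf UNIV (\<lambda>k. 3 * tri k) (\<lambda>k. - 3 * (alt_sign k * k) - alt_sign k)"
  proof (rule gf_reindex[where g = "\<lambda>k. 3 * k + 1" and h = "\<lambda>m. m div 3"])
    have tri3: "tri (3 * k + 1) = 9 * tri k + 1" for k
    proof -
      have "2 * int (tri (3 * k + 1)) = 2 * int (9 * tri k + 1)"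
        using two_tri[of k] two_tri[of "3 * k + 1"] by (simp add: algebra_simps)
      then show ?thesis by simp
    qed
    show "3 * k + 1 \<in> {m. tri m mod 3 = 1}" for k :: int
      by (simp add: tri3) presburger
    show "tri (3 * k + 1) div 3 = 3 * tri k" for k
      by (simp add: tri3)
    show "alt_sign (3 * k + 1) * (3 * k + 1) = - 3 * (alt_sign k * k) - alt_sign k" for k
      by (auto simp: alt_sign_def)
    show "3 * (m div 3) + 1 = m" if "m \<in> {m. tri m mod 3 = 1}" for m
    proof -
      have t: "int (tri m) mod 3 = 1" using that by simp presburger
      have "m mod 3 = 0 \<or> m mod 3 = 1 \<or> m mod 3 = 2" by presburger
      then have "m mod 3 = 1"
      proof (elim disjE)
        assume "m mod 3 = 0"
        then obtain k where "m = 3 * k" by (auto elim!: dvdE)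
        then have "int (tri m) mod 3 = 0" using two_tri[of m] by (simp add: mult.assoc) presburger
        then show ?thesis using t by simp
      next
        assume "m mod 3 = 2"
        then have "m = 3 * (m div 3) + 2" by presburger
        then obtain k where "m = 3 * k + 2" by blast
        then have "2 * int (tri m) = 3 * ((3 * k + 2) * (k + 1))" using two_tri[of m] by
            (simp add: algebra_simps)
        then have "int (tri m) mod 3 = 0" by presburger
        then show ?thesis using t by simp
      qed
      then show ?thesis by presburger
    qed
  qed auto
  also have "\<dots> = - 3 * dil jacobi_series - dil (gf UNIV tri alt_sign)"
    unfolding jacobi_series_def dil_gf
    by (rule fps_ext) (simp add: gf_nth sum_subtractf sum_distrib_left sum_negf
        numeral_fps_const fps_mult_left_const_nth)
  finally show ?thesis by (simp add: gf_alt_sign)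
qed

text \<open>Compare the exponents that are 1 modulo 3 on both sides of
    \<open>hex_B_product\<close>.\<close>

lemma hex_C_product: "hex_C * euler = 3 * dil (euler :: int fps) ^ 3"
proof -
  have "sect 1 ((dil hex_A - fps_X * dil hex_C) * dil euler)
      = sect 1 (dil (hex_A * euler) * fps_X ^ 0) - sect 1 (dil (hex_C * euler :: int fps) * fps_X ^ 1)"
    unfolding sect_diff[symmetric] by (simp add: dil_mult algebra_simps)
  also have "\<dots> = - (hex_C * euler)"
    by (simp only: sect_dil_mult sect_X_power) (simp add: sect_dil_mult sect_X_power)
  finally have "- (hex_C * euler) = sect 1 jacobi_series"
    by (simp add: hex_B_product jacobi_identity)
  then have "- (hex_C * euler) = - (3 * dil jacobi_series)"
    by (simp only: sect_jacobi mult_minus_left)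
  then show ?thesis
    by (simp only: neg_equal_iff_equal jacobi_identity[symmetric] dil_power)
qed

fun ab_diff :: "int3 \<Rightarrow> int" where "ab_diff (a, b, c) = a - b"

text \<open>A third of \<open>hex_C\<close> as a counting series, hence with integer coefficients by
  construction. The class 1 is the one met by the reindexing in \<open>glue_012\<close>.\<close>

definition hex_Y :: "'a::comm_ring_1 fps" where
  "hex_Y = gf {p \<in> row (- 1). ab_diff p mod 3 = 1} twt (\<lambda>_. 1)"

text \<open>Rotating the coordinates preserves \<open>row (- 1)\<close> and \<open>twt\<close> and
  raises \<open>ab_diff\<close> by 1 modulo 3, so the three classes have equal series.\<close>

lemma hex_C_eq_3Y: "hex_C = 3 * (hex_Y :: 'a::comm_ring_1 fps)"
proof -
  have rot: "gf {p \<in> row (- 1). ab_diff p mod 3 = r} twt (\<lambda>_. 1)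
      = gf {p \<in> row (- 1). ab_diff p mod 3 = (r - 1) mod 3} twt (\<lambda>_. 1 :: 'a)"
    if "r \<in> {0, 1, 2}" for r
  proof (rule gf_reindex[where g = "\<lambda>(a, b, c). (b, c, a)" and h = "\<lambda>(a, b, c).
      (c, a, b)"])
    fix p :: int3
    obtain a b c where p: "p = (a, b, c)" by (cases p)
    show "(case p of (a, b, c) \<Rightarrow> (b, c, a)) \<in> {p \<in> row (- 1). ab_diff p mod 3 = r}"
      if "p \<in> {p \<in> row (- 1). ab_diff p mod 3 = (r - 1) mod 3}"
      using that \<open>r \<in> {0, 1, 2}\<close> unfolding p by auto presburger+
    show "(case p of (a, b, c) \<Rightarrow> (c, a, b)) \<in> {p \<in> row (- 1). ab_diff p mod
        3 = (r - 1) mod 3}"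
      if "p \<in> {p \<in> row (- 1). ab_diff p mod 3 = r}"
      using that \<open>r \<in> {0, 1, 2}\<close> unfolding p by auto presburger+
  qed auto
  have "hex_C = (\<Sum>r\<in>{0, 1, 2}. gf {p \<in> row (- 1). ab_diff p mod 3 = r} twt
      (\<lambda>_. 1 :: 'a))"
    unfolding hex_C_def by (rule gf_partition[OF finite_fibres_twt]) auto
  then show ?thesis
    using rot[of 1] rot[of 2] by (simp add: hex_Y_def)
qed

subsection \<open>The theta series of the lattice A8\<close>

fun shift3 :: "int \<Rightarrow> int3 \<Rightarrow> int3" where "shift3 t (a, b, c) = (a + t, b + t,
    c + t)"

text \<open>The change of \<open>twt\<close> when a triple of sum \<open>- r\<close> is shifted by
  \<open>t\<close>, since \<open>tri (a + t) = tri a + tri t + a * t\<close>. For \<open>r\<close>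
  in \<open>{0, 1, 2}\<close> it is nonnegative, so \<open>nat\<close> loses nothing.\<close>

definition swt :: "int \<Rightarrow> int \<Rightarrow> nat" where "swt r t = nat (3 * int (tri t) -
    r * t)"

lemma tsum_shift3: "tsum (shift3 t p) = tsum p + 3 * t"
  by (cases p) simp

lemma shift3_shift3: "shift3 s (shift3 t p) = shift3 (s + t) p"
  by (cases p) (simp add: add_ac)

lemma shift3_0: "shift3 0 p = p"
  by (cases p) simp

lemma two_swt:
  assumes "r \<in> {0, 1, 2}"
  shows "2 * int (swt r t) = 3 * t * (t + 1) - 2 * r * t" "\<bar>t\<bar> - 1 \<le> int (swt r t)"
proof -
  have tt: "2 * (3 * int (tri t) - r * t) = 3 * t * (t + 1) - 2 * r * t"
    using two_tri[of t] by (simp add: algebra_simps)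
  have pos: "2 * \<bar>t\<bar> - 2 \<le> 3 * t * (t + 1) - 2 * r * t \<and> 0 \<le> 3 * t * (t +
      1) - 2 * r * t"
  proof -
    have sq: "0 \<le> (3 * x - 2) * (x - 1)" "0 \<le> 3 * (x * (x - 1))" if "0 \<le> x" for x :: int
    proof -
      show "0 \<le> (3 * x - 2) * (x - 1)"
        using that by (cases "x = 0") auto
      show "0 \<le> 3 * (x * (x - 1))"
        using that by (cases "x = 0") auto
    qed
    have "- 3 * \<bar>t\<bar> \<le> (3 - 2 * r) * t"
      using assms by (auto simp: abs_if)
    then have "3 * \<bar>t\<bar> * \<bar>t\<bar> - 3 * \<bar>t\<bar> \<le> 3 * t * (t + 1) - 2 * r * t"
      by (simp add: algebra_simps)
    moreover have "0 \<le> 3 * \<bar>t\<bar> * \<bar>t\<bar> - 5 * \<bar>t\<bar> + 2" "0 \<le>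
        3 * \<bar>t\<bar> * \<bar>t\<bar> - 3 * \<bar>t\<bar>"
      using sq[of "\<bar>t\<bar>"] by (simp_all add: algebra_simps)
    ultimately show ?thesis by linarith
  qed
  then have "0 \<le> 2 * (3 * int (tri t) - r * t)" unfolding tt by blast
  then have "0 \<le> 3 * int (tri t) - r * t" by simp
  then have "int (swt r t) = 3 * int (tri t) - r * t" by (simp add: swt_def)
  then show eq: "2 * int (swt r t) = 3 * t * (t + 1) - 2 * r * t"
    using tt by metis
  show "\<bar>t\<bar> - 1 \<le> int (swt r t)"
    using pos unfolding eq[symmetric] by linarith
qed

lemma twt_shift3:
  assumes "p \<in> row (- r)" "r \<in> {0, 1, 2}"
  shows "twt (shift3 t p) = twt p + swt r t"
proof -
  obtain a b c where p: "p = (a, b, c)" by (cases p)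
  have c: "c = - r - a - b" using assms(1) by (simp add: p)
  show ?thesis
    unfolding p c shift3.simps
    using two_twt[of "a + t" "b + t" "- r - a - b + t"] two_twt[of a b "- r - a - b"]
        two_swt(1)[OF assms(2), of t]
    by (intro twt_eqI) (simp add: algebra_simps del: twt.simps)
qed

fun swt3 :: "int3 \<Rightarrow> int3 \<Rightarrow> nat" where
  "swt3 (r1, r2, r3) (t1, t2, t3) = swt r1 t1 + swt r2 t2 + swt r3 t3"

text \<open>
  A triple of rows whose sums are \<open>3 t\<^sub>i - r\<^sub>i\<close> is shifted to rows with
      sums \<open>- r\<^sub>i\<close>;
  \<open>glue\<close> records the contribution of the shifts \<open>t\<^sub>i\<close>.
\<close>

definition glue :: "int \<Rightarrow> int \<Rightarrow> int \<Rightarrow> 'a::comm_ring_1 fps" where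
  "glue r1 r2 r3 = gf {t. 3 * tsum t = r1 + r2 + r3} (swt3 (r1, r2, r3)) (\<lambda>_. 1)"

lemma finite_fibres_swt3:
  assumes "r1 \<in> {0, 1, 2}" "r2 \<in> {0, 1, 2}" "r3 \<in> {0, 1, 2}"
  shows "finite_fibres I (swt3 (r1, r2, r3))"
proof -
  have "finite {t \<in> UNIV. swt3 (r1, r2, r3) t = n}" for n
  proof (rule finite_subset)
    let ?I = "{- int n - 1..int n + 1}"
    show "{t \<in> UNIV. swt3 (r1, r2, r3) t = n} \<subseteq> ?I \<times> ?I \<times> ?I"
    proof
      fix t assume t: "t \<in> {t \<in> UNIV. swt3 (r1, r2, r3) t = n}"
      obtain a b c where t_eq: "t = (a, b, c)" by (cases t)
      from t have "swt r1 a \<le> n" "swt r2 b \<le> n" "swt r3 c \<le> n" by (auto simp: t_eq)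
      then show "t \<in> ?I \<times> ?I \<times> ?I"
        using two_swt(2)[OF assms(1), of a] two_swt(2)[OF assms(2), of b] two_swt(2)[OF assms(3), of c]
        by (auto simp: t_eq)
    qed
    show "finite (?I \<times> ?I \<times> ?I)" by simp
  qed
  then have "finite_fibres UNIV (swt3 (r1, r2, r3))" by (simp add: finite_fibres_def)
  then show ?thesis by (rule finite_fibres_subset) simp
qed

definition row_gf :: "int \<Rightarrow> 'a::comm_ring_1 fps" where
  "row_gf s = gf (row s) twt (\<lambda>_. 1)"

fun row_class :: "int3 \<times> int3 \<times> int3 \<Rightarrow> int3" where
  "row_class (p1, p2, p3) = ((- tsum p1) mod 3, (- tsum p2) mod 3, (- tsum p3) mod 3)"

fun wt9 :: "int3 \<times> int3 \<times> int3 \<Rightarrow> nat" where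
  "wt9 (p1, p2, p3) = twt p1 + twt p2 + twt p3"

fun sum9 :: "int3 \<times> int3 \<times> int3 \<Rightarrow> int" where
  "sum9 (p1, p2, p3) = tsum p1 + tsum p2 + tsum p3"

fun glue_map :: "int3 \<times> int3 \<times> int3 \<times> int3 \<Rightarrow> int3 \<times> int3
    \<times> int3" where
  "glue_map (q1, q2, q3, t1, t2, t3) = (shift3 t1 q1, shift3 t2 q2, shift3 t3 q3)"

text \<open>A row sum is written as \<open>3 t - r\<close> with \<open>r\<close> its negative modulo
  3, which forces this \<open>t\<close>.\<close>

fun unglue :: "int3 \<times> int3 \<times> int3 \<Rightarrow> int3 \<times> int3 \<times> int3
    \<times> int3" where
  "unglue (p1, p2, p3) =
    (let t = (\<lambda>p. - ((- tsum p) div 3)) in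
     (shift3 (- t p1) p1, shift3 (- t p2) p2, shift3 (- t p3) p3, t p1, t p2, t p3))"

lemma gf_times_1:
  assumes "finite_fibres I w" "finite_fibres J v"
  shows "gf I w (\<lambda>_. 1) * gf J v (\<lambda>_. 1)
    = gf (I \<times> J) (\<lambda>x. w (fst x) + v (snd x)) (\<lambda>_. 1 :: 'a::comm_ring_1)"
  unfolding gf_times[OF assms] by (simp add: case_prod_unfold)

text \<open>Each row is uniquely a shift of a row of sum \<open>- r\<close>. Weights add by
  \<open>twt_shift3\<close>, and total sum zero involves the shifts alone, as
  \<open>3 * (t1 + t2 + t3) = r1 + r2 + r3\<close>.\<close>

lemma class_gf:
  assumes r: "r1 \<in> {0, 1, 2}" "r2 \<in> {0, 1, 2}" "r3 \<in> {0, 1, 2}"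
  shows "gf {x. sum9 x = 0 \<and> row_class x = (r1, r2, r3)} wt9 (\<lambda>_. 1)
    = row_gf (- r1) * (row_gf (- r2) * (row_gf (- r3) * (glue r1 r2 r3 :: 'a::comm_ring_1 fps)))"
proof -
  let ?T = "{t. 3 * tsum t = r1 + r2 + r3}"
  let ?J = "row (- r1) \<times> row (- r2) \<times> row (- r3) \<times> ?T"
  note fT = finite_fibres_swt3[OF r, of ?T]
  note f3 = finite_fibres_Times[OF finite_fibres_twt[of "row (- r3)"] fT, unfolded case_prod_unfold]
  note f2 = finite_fibres_Times[OF finite_fibres_twt[of "row (- r2)"] f3, unfolded case_prod_unfold]
  have "row_gf (- r1) * (row_gf (- r2) * (row_gf (- r3) * (glue r1 r2 r3 :: 'a fps)))
    = gf ?J (\<lambda>(q1, q2, q3, t). twt q1 + (twt q2 + (twt q3 + swt3 (r1, r2, r3) t)))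
        (\<lambda>_. 1)"
    unfolding row_gf_def glue_def
      gf_times_1[OF finite_fibres_twt fT] gf_times_1[OF finite_fibres_twt f3] gf_times_1[OF
          finite_fibres_twt f2]
    by (simp add: case_prod_unfold)
  moreover have "gf {x. sum9 x = 0 \<and> row_class x = (r1, r2, r3)} wt9 (\<lambda>_. 1)
    = gf ?J (\<lambda>(q1, q2, q3, t). twt q1 + (twt q2 + (twt q3 + swt3 (r1, r2, r3) t)))
        (\<lambda>_. 1 :: 'a)"
  proof (rule gf_reindex[where g = glue_map and h = unglue])
    have tdiv: "(- (- r + 3 * t)) div 3 = - t \<and> (- (- r + 3 * t)) mod 3 = r" if "r \<in>
        {0, 1, 2}" for r t :: int
    proof -
      have "- (- r + 3 * t) = r + 3 * (- t)" by simp
      moreover have "(r + 3 * (- t)) div 3 = - t" "(r + 3 * (- t)) mod 3 = r"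
        using that by (auto; presburger)+
      ultimately show ?thesis by metis
    qed
    fix x assume x: "x \<in> ?J"
    obtain q1 q2 q3 t1 t2 t3 where x_eq: "x = (q1, q2, q3, t1, t2, t3)" by (metis prod_cases3)
    have q: "tsum q1 = - r1" "tsum q2 = - r2" "tsum q3 = - r3" "3 * (t1 + t2 + t3) = r1 + r2 + r3"
      using x by (simp_all add: x_eq row_def)
    show "unglue (glue_map x) = x"
      using tdiv[OF r(1), of t1] tdiv[OF r(2), of t2] tdiv[OF r(3), of t3]
      by (simp add: x_eq tsum_shift3 q shift3_shift3 shift3_0 Let_def del: minus_add_distrib)
    show "glue_map x \<in> {x. sum9 x = 0 \<and> row_class x = (r1, r2, r3)}"
      using tdiv[OF r(1), of t1] tdiv[OF r(2), of t2] tdiv[OF r(3), of t3] q(4)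
      by (simp add: x_eq tsum_shift3 q del: minus_add_distrib)
    show "wt9 (glue_map x) = (case x of (q1, q2, q3, t) \<Rightarrow> twt q1 + (twt q2 + (twt q3
        + swt3 (r1, r2, r3) t)))"
    proof -
      have m: "q1 \<in> row (- r1)" "q2 \<in> row (- r2)" "q3 \<in> row (- r3)"
        using x by (simp_all add: x_eq)
      show ?thesis
        by (simp add: x_eq twt_shift3[OF m(1) r(1)] twt_shift3[OF m(2) r(2)] twt_shift3[OF m(3) r(3)])
    qed
  next
    fix x assume x: "x \<in> {x. sum9 x = 0 \<and> row_class x = (r1, r2, r3)}"
    obtain p1 p2 p3 where x_eq: "x = (p1, p2, p3)" by (cases x)
    have p: "tsum p1 + tsum p2 + tsum p3 = 0" "(- tsum p1) mod 3 = r1" "(- tsum p2) mod 3 = r2"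
        "(- tsum p3) mod 3 = r3"
      using x by (simp_all add: x_eq)
    have e: "tsum p = - ((- tsum p) mod 3) - 3 * ((- tsum p) div 3)" for p
      by presburger
    show "glue_map (unglue x) = x"
      by (simp add: x_eq Let_def shift3_shift3 shift3_0)
    show "unglue x \<in> ?J"
      using e[of p1] e[of p2] e[of p3] p
      by (simp add: x_eq Let_def row_def tsum_shift3)
  qed simp
  ultimately show ?thesis by simp
qed

lemma glue_swap12: "glue r2 r1 r3 = glue r1 r2 r3"
  unfolding glue_def
  by (rule gf_reindex[where g = "\<lambda>(a, b, c). (b, a, c)" and h = "\<lambda>(a, b, c). (b,
      a, c)"]) auto

lemma glue_swap23: "glue r1 r3 r2 = glue r1 r2 r3"
  unfolding glue_def
  by (rule gf_reindex[where g = "\<lambda>(a, b, c). (a, c, b)" and h = "\<lambda>(a, b, c). (a,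
      c, b)"]) auto

lemma glue_empty: "(r1 + r2 + r3) mod 3 \<noteq> 0 \<Longrightarrow> glue r1 r2 r3 = 0"
proof -
  assume "(r1 + r2 + r3) mod 3 \<noteq> 0"
  then have empty: "{t. 3 * tsum t = r1 + r2 + r3} = {}"
    by (metis (mono_tags, lifting) Collect_empty_eq mod_mult_self1_is_0)
  show ?thesis
    unfolding glue_def empty by (intro fps_ext) (simp add: gf_nth)
qed

lemma glue_000: "glue 0 0 0 = dil (hex_A :: 'a::idom fps)"
  unfolding glue_def hex_A_def dil_gf
  by (rule gf_cong) (auto simp: row_def swt_def)

text \<open>The shifts have sum 1, so negation takes them to \<open>row (- 1)\<close>.\<close>

lemma glue_111: "glue 1 1 1 = fps_X ^ 2 * dil (hex_C :: 'a::idom fps)"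
  unfolding glue_def hex_C_def dil_gf gf_shift
proof (rule gf_reindex[where g = "\<lambda>(a, b, c). (- a, - b, - c)" and h = "\<lambda>(a, b, c).
    (- a, - b, - c)"])
  fix p :: int3 assume p: "p \<in> row (- 1)"
  obtain a b c where p_eq: "p = (a, b, c)" by (cases p)
  have a: "a = - 1 - b - c" using p by (simp add: p_eq)
  have r: "(1::int) \<in> {0, 1, 2}" by simp
  have "2 * int (swt 1 (- a) + swt 1 (- b) + swt 1 (- c)) = 2 * int (3 * (tri a + tri b + tri c) + 2)"
    using two_tri[of a] two_tri[of b] two_tri[of c] two_swt(1)[OF r, of "- a"] two_swt(1)[OF r,
        of "- b"] two_swt(1)[OF r, of "- c"]
    unfolding a by (simp add: algebra_simps)
  then show "swt3 (1, 1, 1) (case p of (a, b, c) \<Rightarrow> (- a, - b, - c)) = 3 * twt p + 2"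
    by (simp add: p_eq)
qed auto

text \<open>The shifts have sum 2, so lowering every coordinate by 1 takes them to
  \<open>row (- 1)\<close>.\<close>

lemma glue_222: "glue 2 2 2 = fps_X ^ 2 * dil (hex_C :: 'a::idom fps)"
  unfolding glue_def hex_C_def dil_gf gf_shift
proof (rule gf_reindex[where g = "shift3 1" and h = "shift3 (- 1)"])
  fix p :: int3 assume p: "p \<in> row (- 1)"
  obtain a b c where p_eq: "p = (a, b, c)" by (cases p)
  have a: "a = - 1 - b - c" using p by (simp add: p_eq)
  have r: "(2::int) \<in> {0, 1, 2}" by simp
  have "2 * int (swt 2 (a + 1) + swt 2 (b + 1) + swt 2 (c + 1)) = 2 * int (3 * (tri a + tri b +
      tri c) + 2)"
    using two_tri[of a] two_tri[of b] two_tri[of c] two_swt(1)[OF r, of "a + 1"] two_swt(1)[OF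
        r, of "b + 1"] two_swt(1)[OF r, of "c + 1"]
    unfolding a by (simp add: algebra_simps)
  then show "swt3 (2, 2, 2) (shift3 1 p) = 3 * twt p + 2"
    by (simp add: p_eq)
qed (auto simp: shift3_shift3 shift3_0 row_def tsum_shift3)

text \<open>With three different residues the minimum of the form is displaced, and the
  norm-tripling difference map, with 1 subtracted in the last coordinate, lands in one class of
  \<open>row (- 1)\<close>. It absorbs the factor 3 in \<open>swt\<close>, so \<open>hex_Y\<close>
  appears undilated.\<close>

lemma glue_012: "glue 0 1 2 = fps_X * (hex_Y :: 'a::comm_ring_1 fps)"
proof -
  have "fps_X * (hex_Y :: 'a fps) = gf {p \<in> row (- 1). ab_diff p mod 3 = 1} (\<lambda>p. twt p
      + 1) (\<lambda>_. 1)"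
    unfolding hex_Y_def using gf_shift[of 1] by simp
  also have "\<dots> = glue 0 1 2"
    unfolding glue_def
  proof (rule gf_reindex[where g = "\<lambda>(a, b, c). (a - b, b - c, c - a - 1)" and
        h = "\<lambda>(a, b, c). (a + (1 - (a - b)) div 3, (1 - (a - b)) div 3, (1 - (a -
            b)) div 3 - b)"])
    fix p :: int3 assume p: "p \<in> {p \<in> row (- 1). ab_diff p mod 3 = 1}"
    obtain a b c where p_eq: "p = (a, b, c)" by (cases p)
    define k where "k = (1 - (a - b)) div 3"
    have k: "a = b + 1 - 3 * k" "c = - 2 - 2 * b + 3 * k"
      using p unfolding p_eq k_def by (simp_all, presburger+)
    have k2: "(1 - (b + 1 - 3 * k - b)) div 3 = k" by simp
    show "(case case p of (a, b, c) \<Rightarrow> (a + (1 - (a - b)) div 3, (1 - (a - b)) div 3,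
        (1 - (a - b)) div 3 - b) of
        (a, b, c) \<Rightarrow> (a - b, b - c, c - a - 1)) = p"
      unfolding p_eq k prod.case k2 by simp
    show "(case p of (a, b, c) \<Rightarrow> (a + (1 - (a - b)) div 3, (1 - (a - b)) div 3, (1 -
        (a - b)) div 3 - b))
        \<in> {t. 3 * tsum t = 0 + 1 + 2}"
      unfolding p_eq k prod.case k2 by simp
  next
    fix p :: int3 assume p: "p \<in> {t. 3 * tsum t = 0 + 1 + 2}"
    obtain a b c where p_eq: "p = (a, b, c)" by (cases p)
    have c: "c = 1 - a - b" using p by (simp add: p_eq)
    have k2: "(1 - ((a - b) - (b - (1 - a - b)))) div 3 = b" by simp
    show "(case case p of (a, b, c) \<Rightarrow> (a - b, b - c, c - a - 1) of
        (a, b, c) \<Rightarrow> (a + (1 - (a - b)) div 3, (1 - (a - b)) div 3, (1 - (a - b))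
            div 3 - b)) = p"
      unfolding p_eq c prod.case k2 by simp
    show "(case p of (a, b, c) \<Rightarrow> (a - b, b - c, c - a - 1)) \<in> {p \<in> row (-
        1). ab_diff p mod 3 = 1}"
      unfolding p_eq c by simp presburger
    have r: "(0::int) \<in> {0, 1, 2}" "(1::int) \<in> {0, 1, 2}" "(2::int) \<in> {0, 1, 2}" by simp_all
    have "2 * int (twt (a - b, b - c, c - a - 1) + 1) = 2 * int (swt 0 a + swt 1 b + swt 2 c)"
      using two_twt[of "a - b" "b - c" "c - a - 1"] two_swt(1)[OF r(1), of a] two_swt(1)[OF
          r(2), of b] two_swt(1)[OF r(3), of c]
      unfolding c by (simp add: algebra_simps del: twt.simps)
    then show "twt (case p of (a, b, c) \<Rightarrow> (a - b, b - c, c - a - 1)) + 1 = swt3 (0, 1, 2) p"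
      by (simp add: p_eq)
  qed simp
  finally show ?thesis by simp
qed

lemma row_gf_0: "row_gf 0 = hex_A"
  by (simp add: row_gf_def hex_A_def)

lemma row_gf_m1: "row_gf (- 1) = hex_C"
  by (simp add: row_gf_def hex_C_def)

lemma row_gf_m2: "row_gf (- 2) = hex_C"
  unfolding row_gf_def hex_C_def
  by (rule gf_reindex[where g = "\<lambda>(a, b, c). (- 1 - a, - 1 - b, - 1 - c)" and h =
      "\<lambda>(a, b, c). (- 1 - a, - 1 - b, - 1 - c)"])
     (auto simp: tri_reflect)

text \<open>Of the 27 residue classes only nine have a sum divisible by 3: three constant triples
  and the six permutations of \<open>(0, 1, 2)\<close>.\<close>

lemma theta_A8:
  "gf {x. sum9 x = 0} wt9 (\<lambda>_. 1) = hex_A ^ 3 * dil hex_A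
    + 2 * fps_X ^ 2 * hex_C ^ 3 * dil hex_C + 6 * fps_X * hex_A * hex_C ^ 2 * (hex_Y :: 'a::idom fps)"
proof -
  let ?R = "{0, 1, 2} :: int set"
  have fin: "finite_fibres {x. sum9 x = 0} wt9"
  proof -
    have "finite_fibres (UNIV \<times> UNIV \<times> UNIV) (\<lambda>(p1, p2, p3). twt p1 + (twt
        p2 + twt p3))"
      using finite_fibres_Times[OF finite_fibres_twt[of UNIV] finite_fibres_Times[OF
          finite_fibres_twt[of UNIV] finite_fibres_twt[of UNIV]]]
      by (simp add: case_prod_unfold)
    moreover have "(\<lambda>(p1, p2, p3). twt p1 + (twt p2 + twt p3)) = wt9"
      by (rule ext) auto
    ultimately show ?thesis by (metis finite_fibres_subset UNIV_Times_UNIV subset_UNIV)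
  qed
  have "gf {x. sum9 x = 0} wt9 (\<lambda>_. 1 :: 'a)
      = (\<Sum>r\<in>?R \<times> ?R \<times> ?R. gf {x \<in> {x. sum9 x = 0}. row_class x = r}
          wt9 (\<lambda>_. 1))"
  proof (rule gf_partition[OF fin])
    have m: "m mod 3 \<in> ?R" for m :: int by auto
    show "row_class ` {x. sum9 x = 0} \<subseteq> ?R \<times> ?R \<times> ?R"
    proof
      fix y assume "y \<in> row_class ` {x. sum9 x = 0}"
      then obtain p1 p2 p3 where "y = row_class (p1, p2, p3)" by auto
      then show "y \<in> ?R \<times> ?R \<times> ?R" using m by (simp only: row_class.simps
          mem_Sigma_iff simp_thms)
    qed
  qed simp
  also have "\<dots> = (\<Sum>(r1, r2, r3)\<in>?R \<times> ?R \<times> ?R.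
      row_gf (- r1) * (row_gf (- r2) * (row_gf (- r3) * glue r1 r2 r3)))"
  proof (rule sum.cong[OF refl])
    fix r assume "r \<in> ?R \<times> ?R \<times> ?R"
    then obtain r1 r2 r3 where r: "r = (r1, r2, r3)" "r1 \<in> ?R" "r2 \<in> ?R" "r3 \<in> ?R" by blast
    show "gf {x \<in> {x. sum9 x = 0}. row_class x = r} wt9 (\<lambda>_. 1 :: 'a) =
      (case r of (r1, r2, r3) \<Rightarrow> row_gf (- r1) * (row_gf (- r2) * (row_gf (-
          r3) * glue r1 r2 r3)))"
      unfolding r(1) prod.case class_gf[OF r(2-4), symmetric] by simp
  qed
  also have "\<dots> = (\<Sum>r1\<in>?R. \<Sum>r2\<in>?R. \<Sum>r3\<in>?R. row_gf (- r1) * (row_gf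
      (- r2) * (row_gf (- r3) * glue r1 r2 r3)))"
    by (simp only: sum.cartesian_product)
  also have "\<dots> = hex_A ^ 3 * dil hex_A
    + 2 * fps_X ^ 2 * hex_C ^ 3 * dil hex_C + 6 * fps_X * hex_A * hex_C ^ 2 * hex_Y"
  proof -
    have g: "glue 0 2 1 = fps_X * (hex_Y :: 'a fps)" "glue 1 0 2 = fps_X * (hex_Y :: 'a fps)"
      "glue 1 2 0 = fps_X * (hex_Y :: 'a fps)" "glue 2 0 1 = fps_X * (hex_Y :: 'a fps)"
      "glue 2 1 0 = fps_X * (hex_Y :: 'a fps)"
      by (metis glue_012 glue_swap12 glue_swap23)+
    have z: "glue 0 0 1 = (0 :: 'a fps)" "glue 0 0 2 = (0 :: 'a fps)" "glue 0 1 0 = (0 :: 'a fps)"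
      "glue 0 1 1 = (0 :: 'a fps)" "glue 0 2 0 = (0 :: 'a fps)" "glue 0 2 2 = (0 :: 'a fps)"
      "glue 1 0 0 = (0 :: 'a fps)" "glue 1 0 1 = (0 :: 'a fps)" "glue 1 1 0 = (0 :: 'a fps)"
      "glue 1 1 2 = (0 :: 'a fps)" "glue 1 2 1 = (0 :: 'a fps)" "glue 1 2 2 = (0 :: 'a fps)"
      "glue 2 0 0 = (0 :: 'a fps)" "glue 2 0 2 = (0 :: 'a fps)" "glue 2 1 1 = (0 :: 'a fps)"
      "glue 2 1 2 = (0 :: 'a fps)" "glue 2 2 0 = (0 :: 'a fps)" "glue 2 2 1 = (0 :: 'a fps)"
      by (rule glue_empty, simp)+
    show ?thesis
      by (simp add: g z glue_000 glue_111 glue_222 glue_012 row_gf_0 row_gf_m1 row_gf_m2)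
         (simp add: algebra_simps power2_eq_square power3_eq_cube)
  qed
  finally show ?thesis .
qed

lemma cphi_9_series:
  "Abs_fps (\<lambda>n. int (cphi 9 n)) = partition_gf ^ 9 * (hex_A ^ 3 * dil hex_A
    + 2 * fps_X ^ 2 * hex_C ^ 3 * dil hex_C + 6 * fps_X * hex_A * hex_C ^ 2 * hex_Y)"
proof -
  have "gf {(p1, p2, p3). tsum p1 + tsum p2 + tsum p3 = 0} (\<lambda>(p1, p2, p3). twt p1 + twt p2
      + twt p3) (\<lambda>_. 1 :: int)
    = gf {x. sum9 x = 0} wt9 (\<lambda>_. 1)"
    by (rule gf_cong) auto
  then show ?thesis using cphi_9_gf[where 'a = int] by (simp add: theta_A8)
qed

subsection \<open>Polynomial certificates modulo powers of 3\<close>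

text \<open>Substitutes \<open>t = n / u\<close> into a polynomial of degree at most
  \<open>d\<close> without dividing.\<close>

lemma clear_denominators:
  fixes u t n :: "'a::comm_ring_1"
  assumes "u * t = n" "i \<le> d"
  shows "u ^ d * t ^ i = u ^ (d - i) * n ^ i"
proof -
  have "u ^ d = u ^ (d - i) * u ^ i"
    using assms(2) by (simp flip: power_add)
  then show ?thesis
    by (simp add: assms(1)[symmetric] power_mult_distrib mult.assoc)
qed

text \<open>
  The certificates expand series in \<open>t\<close> as polynomials in \<open>w\<close> modulo
      \<open>3 ^ 14\<close>, with
  denominators \<open>1 - 3 w\<close> and \<open>1 + 6 w\<close> cleared. The result is grouped by
      degree modulo 3,
  and the explicit powers of 3 are those of the theorem.
\<close>

lemma certificate_init:
  fixes w :: "'a::idom"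
  shows "(1 + 6 * w) ^ 3 + 54 * w * (1 + 9 * w) * (1 + 3 * w + 9 * w ^ 2)
    - (1 - 3 * w) ^ 3 * ((1 + 13122 * w ^ 3 + 2125764 * w ^ 6) + w * (3 ^ 4 * (1 + 1053 * w ^ 3
        - 4374 * w ^ 6)) + w ^ 2 * (3 ^ 6 * (2 + 621 * w ^ 3 - 729 * w ^ 6)))
    = 3 ^ 14 * (2 * w ^ 7 - 10 * w ^ 8 + 13 * w ^ 9 + w ^ 10 - 3 * w ^ 11)"
  by algebra

text \<open>The polynomial in \<open>t\<close> is the class of degree 0 in
  \<open>certificate_init\<close>. The factors \<open>1 + 6 w\<close> and \<open>1 - 3 w\<close> are
  the numerator and denominator of \<open>A f ^ 3\<close> relative to \<open>f (q ^ 3)\<close>, and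
  \<open>u ^ 2\<close> clears \<open>t ^ 2\<close>.\<close>

lemma certificate_1:
  fixes w t u n :: "'a::idom"
  assumes "u * t = n" and u: "u = (1 + 6 * w) ^ 3" and n: "n = w * (1 + 3 * w + 9 * w ^ 2)"
  shows "u ^ 2 * ((1 + 6 * w) * (1 + 13122 * t + 2125764 * t ^ 2))
    - (1 - 3 * w) * u ^ 2 * ((1 - 767556 * w ^ 3 - 1592136 * w ^ 6 + 59049 * w ^ 9 +
        1594323 * w ^ 12) + w * (3 ^ 2 * (1459 - 137754 * w ^ 3 + 729 * w ^ 6 + 19683 * w ^ 9)) +
        w ^ 2 * (3 ^ 3 * (75817 - 78705 * w ^ 3 + 729 * w ^ 6 + 19683 * w ^ 9)))
    = 3 ^ 14 * (- (9 * w ^ 3) - 154 * w ^ 4 - 983 * w ^ 5 - 1969 * w ^ 6 + 7439 * w ^ 7 +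
        41472 * w ^ 8 + 45684 * w ^ 9 - 49680 * w ^ 10 - 81648 * w ^ 11 - 93312 * w ^ 12 -
        46655 * w ^ 13 + 36 * w ^ 14 + 540 * w ^ 15 + 4320 * w ^ 16 + 19440 * w ^ 17 +
        46656 * w ^ 18 + 46656 * w ^ 19)"
proof -
  have "u ^ 2 * ((1 + 6 * w) * (1 + 13122 * t + 2125764 * t ^ 2)) = (1 +
      6 * w) * (1 * (u ^ 2 * t ^ 0) + 13122 * (u ^ 2 * t ^ 1) + 2125764 * (u ^ 2 * t ^ 2))"
    by algebra
  also have "\<dots> = (1 + 6 * w) * (1 * (u ^ 2 * n ^ 0) + 13122 * (u ^ 1 * n ^ 1) +
      2125764 * (u ^ 0 * n ^ 2))"
    using clear_denominators[OF assms(1), of 0 2] clear_denominators[OF assms(1), of 1 2]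
        clear_denominators[OF assms(1), of 2 2] by simp
  finally show ?thesis unfolding u n by algebra
qed

text \<open>The polynomial in \<open>t\<close> is \<open>t\<close> times the class of degree 2 in
  \<open>certificate_1\<close>. No \<open>1 - 3 w\<close> arises, because \<open>f\<close> enters
  only through \<open>f (q ^ 3)\<close>.\<close>

lemma certificate_2:
  fixes w t u n :: "'a::idom"
  assumes "u * t = n" and u: "u = (1 + 6 * w) ^ 3" and n: "n = w * (1 + 3 * w + 9 * w ^ 2)"
  shows "u ^ 4 * ((1 + 6 * w) * (2047059 * t - 2125035 * t ^ 2 + 19683 * t ^ 3 + 531441 * t ^ 4))
    - u ^ 4 * (3 ^ 7 * (731 * w ^ 3 + 324 * w ^ 6 + 729 * w ^ 9) + w * (3 ^ 3 * (75817 -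
        57996 * w ^ 3 - 63423 * w ^ 6 + 59049 * w ^ 9)) + w ^ 2 * (3 ^ 5 * (- (5830) + 621 * w ^ 3 -
        7290 * w ^ 6)))
    = 3 ^ 14 * (- (4 * w ^ 2) - 243 * w ^ 3 - 6713 * w ^ 4 - 111155 * w ^ 5 - 1223334 * w ^ 6 -
        9371411 * w ^ 7 - 50797536 * w ^ 8 - 193676174 * w ^ 9 - 503531961 * w ^ 10 -
        829300048 * w ^ 11 - 713690919 * w ^ 12 - 68937066 * w ^ 13 + 396071856 * w ^ 14 +
        606714624 * w ^ 15 + 997505280 * w ^ 16 + 1185249024 * w ^ 17 + 1698091776 * w ^ 18 +
        322486272 * w ^ 19 - 1975228416 * w ^ 20 - 2176782336 * w ^ 21 - 725594112 * w ^ 22)"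
proof -
  have "u ^ 4 * ((1 + 6 * w) * (2047059 * t - 2125035 * t ^ 2 + 19683 * t ^ 3 + 531441 * t ^ 4)) =
      (1 + 6 * w) * (2047059 * (u ^ 4 * t ^ 1) - 2125035 * (u ^ 4 * t ^ 2) + 19683 * (u ^ 4 * t ^ 3)
      + 531441 * (u ^ 4 * t ^ 4))"
    by algebra
  also have "\<dots> = (1 + 6 * w) * (2047059 * (u ^ 3 * n ^ 1) - 2125035 * (u ^ 2 * n ^ 2) +
      19683 * (u ^ 1 * n ^ 3) + 531441 * (u ^ 0 * n ^ 4))"
    using clear_denominators[OF assms(1), of 1 4] clear_denominators[OF assms(1), of 2 4]
        clear_denominators[OF assms(1), of 3 4] clear_denominators[OF assms(1), of 4 4] by simp
  finally show ?thesis unfolding u n by algebra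
qed

text \<open>The polynomial in \<open>t\<close> is the class of degree 0 in
  \<open>certificate_2\<close>.\<close>

lemma certificate_3:
  fixes w t u n :: "'a::idom"
  assumes "u * t = n" and u: "u = (1 + 6 * w) ^ 3" and n: "n = w * (1 + 3 * w + 9 * w ^ 2)"
  shows "u ^ 3 * ((1 + 6 * w) * (1598697 * t + 708588 * t ^ 2 + 1594323 * t ^ 3))
    - (1 - 3 * w) * u ^ 3 * (3 ^ 9 * (68 * w ^ 3 - 108 * w ^ 6) + w * (3 ^ 7 * (731 -
        918 * w ^ 3 - 729 * w ^ 6)) + w ^ 2 * (3 ^ 8 * (104 + 135 * w ^ 3)))
    = 3 ^ 14 * (- (2 * w ^ 2) - 84 * w ^ 3 - 1467 * w ^ 4 - 13241 * w ^ 5 - 57790 * w ^ 6 -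
        5519 * w ^ 7 + 1256312 * w ^ 8 + 6495903 * w ^ 9 + 15648930 * w ^ 10 + 18734976 * w ^ 11 +
        8748000 * w ^ 12 - 3965760 * w ^ 13 - 13436928 * w ^ 14 - 15116544 * w ^ 15 -
        25194240 * w ^ 16 - 10077696 * w ^ 17)"
proof -
  have "u ^ 3 * ((1 + 6 * w) * (1598697 * t + 708588 * t ^ 2 + 1594323 * t ^ 3)) = (1 +
      6 * w) * (1598697 * (u ^ 3 * t ^ 1) + 708588 * (u ^ 3 * t ^ 2) + 1594323 * (u ^ 3 * t ^ 3))"
    by algebra
  also have "\<dots> = (1 + 6 * w) * (1598697 * (u ^ 2 * n ^ 1) + 708588 * (u ^ 1 * n ^ 2) +
      1594323 * (u ^ 0 * n ^ 3))"
    using clear_denominators[OF assms(1), of 1 3] clear_denominators[OF assms(1), of 2 3]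
        clear_denominators[OF assms(1), of 3 3] by simp
  finally show ?thesis unfolding u n by algebra
qed

text \<open>The polynomial in \<open>t\<close> is \<open>t\<close> times the class of degree 2 in
  \<open>certificate_3\<close>.\<close>

lemma certificate_4:
  fixes w t u n :: "'a::idom"
  assumes "u * t = n" and u: "u = (1 + 6 * w) ^ 3" and n: "n = w * (1 + 3 * w + 9 * w ^ 2)"
  shows "u ^ 2 * ((1 + 6 * w) * (682344 * t + 885735 * t ^ 2))
    - u ^ 2 * (3 ^ 12 * (w ^ 3) + w * (3 ^ 8 * (104 + 162 * w ^ 3)) + w ^ 2 * (3 ^ 10 * (- (8) +
        27 * w ^ 3)))
    = 3 ^ 14 * (- (w ^ 2) - 29 * w ^ 3 - 309 * w ^ 4 - 1543 * w ^ 5 - 3609 * w ^ 6 -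
        3594 * w ^ 7 - 6336 * w ^ 8 - 22032 * w ^ 9 - 25920 * w ^ 10 - 15552 * w ^ 11)"
proof -
  have "u ^ 2 * ((1 + 6 * w) * (682344 * t + 885735 * t ^ 2)) = (1 +
      6 * w) * (682344 * (u ^ 2 * t ^ 1) + 885735 * (u ^ 2 * t ^ 2))"
    by algebra
  also have "\<dots> = (1 + 6 * w) * (682344 * (u ^ 1 * n ^ 1) + 885735 * (u ^ 0 * n ^ 2))"
    using clear_denominators[OF assms(1), of 1 2] clear_denominators[OF assms(1), of 2 2] by simp
  finally show ?thesis unfolding u n by algebra
qed

text \<open>The input is the class of degree 0 in \<open>certificate_4\<close>. Its own class of
  degree 0 vanishes modulo \<open>3 ^ 14\<close>, which yields the last congruence.\<close>

lemma certificate_5: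
  fixes w t u n :: "'a::idom"
  assumes "u * t = n" and u: "u = (1 + 6 * w) ^ 3" and n: "n = w * (1 + 3 * w + 9 * w ^ 2)"
  shows "u ^ 1 * ((1 + 6 * w) * (531441 * t))
    - (1 - 3 * w) * u ^ 1 * (0 + w * (3 ^ 12 * (1)) + w ^ 2 * (3 ^ 13 * (1)))
    = 3 ^ 14 * (- (w ^ 2) - 8 * w ^ 3 + 108 * w ^ 5 + 216 * w ^ 6)"
proof -
  have "u ^ 1 * ((1 + 6 * w) * (531441 * t)) = (1 + 6 * w) * (531441 * (u ^ 1 * t ^ 1))"
    by algebra
  also have "\<dots> = (1 + 6 * w) * (531441 * (u ^ 0 * n ^ 1))"
    using clear_denominators[OF assms(1), of 1 1] by simp
  finally show ?thesis unfolding u n by algebra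
qed

subsection \<open>The cubic theta function identity and the trisection steps\<close>

lemma hex_A_0 [simp]: "hex_A $ 0 = (1 :: int)"
proof -
  have "{p \<in> row 0. twt p = 0} = {(0, 0, 0)}"
  proof -
    have tri0: "m = 0 \<or> m = - 1" if "tri m = 0" for m
      using two_tri[of m] that by auto
    have "p = (0, 0, 0)" if "p \<in> row 0" "twt p = 0" for p
    proof -
      obtain a b c where p: "p = (a, b, c)" by (cases p)
      show ?thesis using that tri0[of a] tri0[of b] tri0[of c] by (auto simp: p)
    qed
    then show ?thesis by (auto simp: tri_def)
  qed
  then show ?thesis by (simp add: hex_A_def gf_nth)
qed

text \<open>The third Borwein function b(q), written through the dissection of a(q).\<close>

definition hex_B :: "int fps" where
  "hex_B = dil hex_A - fps_X * dil hex_C"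

lemma hex_A_eq: "hex_A = dil hex_A + 2 * (fps_X * dil hex_C :: int fps)"
  using hex_A_dissection[where 'a = int] by (simp add: mult.assoc)

lemma hex_Y_euler: "hex_Y * euler = dil (euler :: int fps) ^ 3"
proof -
  have "3 * (hex_Y * euler) = 3 * dil (euler :: int fps) ^ 3"
    using hex_C_product by (simp add: hex_C_eq_3Y mult.assoc)
  then show ?thesis by simp
qed

lemma dil_eq_0_iff: "dil F = 0 \<longleftrightarrow> F = 0"
proof
  assume F: "dil F = 0"
  have "F $ n = 0" for n
    using arg_cong[OF F, of "\<lambda>G. G $ (3 * n)"] by (simp add: dil_nth)
  then show "F = 0" by (simp add: fps_ext)
qed simp

lemma fps_unit_nonzero: "F $ 0 = 1 \<Longrightarrow> F \<noteq> (0 :: 'a::comm_ring_1 fps)"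
  by auto

text \<open>
  If \<open>D\<close> had order \<open>d\<close>, the two sides would have orders \<open>d\<close>
      and at least \<open>3 d + 1\<close>.
  Applied to the defect of the cubic identity, this proves the identity by descent.
\<close>

lemma dil_fixpoint_zero:
  fixes B D G :: "int fps"
  assumes eq: "B * D = fps_X * (G * dil D)" and B: "B $ 0 = 1"
  shows "D = 0"
proof -
  have "D $ n = 0" for n
  proof (induction n rule: less_induct)
    case (less n)
    have "(B * D) $ n = (\<Sum>i\<in>{0..n}. B $ i * D $ (n - i))"
      by (simp add: fps_mult_nth)
    also have "\<dots> = (\<Sum>i\<in>{0..n}. if i = 0 then D $ n else 0)"
      by (rule sum.cong) (use less B in auto)
    finally have l: "(B * D) $ n = D $ n" by simp
    have "(fps_X * (G * dil D)) $ n = 0"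
    proof (cases n)
      case (Suc m)
      have "(G * dil D) $ m = (\<Sum>i\<in>{0..m}. G $ i * dil D $ (m - i))"
        by (simp add: fps_mult_nth)
      also have "\<dots> = 0"
        by (rule sum.neutral) (use less Suc in \<open>auto simp: dil_nth\<close>)
      finally show ?thesis using Suc by (simp add: fps_X_mult_nth)
    qed simp
    then show ?case using l eq by simp
  qed
  then show ?thesis by (simp add: fps_ext)
qed

text \<open>The Borwein identity a^3 = b^3 + c^3. With \<open>A = x + 2 y\<close> and
  \<open>B = x - y\<close>, the product \<open>B (A ^ 3 - B ^ 3)\<close> is
  \<open>9 y (x ^ 3 - y ^ 3)\<close>; since the product formulas turn \<open>B C ^ 3\<close> into
  dilated series, \<open>B\<close> times the defect is \<open>9 y\<close> times the dilated
  defect.\<close>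

lemma hex_cubic_identity: "hex_A ^ 3 = hex_B ^ 3 + 27 * fps_X * (hex_Y :: int fps) ^ 3"
proof -
  define x y where "x = (dil hex_A :: int fps)" and "y = (fps_X * dil hex_C :: int fps)"
  define e where "e = (euler :: int fps)"
  define D where "D = hex_A ^ 3 - hex_B ^ 3 - fps_X * (hex_C :: int fps) ^ 3"
  have A: "hex_A = x + 2 * y" unfolding x_def y_def by (rule hex_A_eq)
  have B: "hex_B = x - y" by (simp add: hex_B_def x_def y_def)
  have Be: "hex_B * dil e = e ^ 3" unfolding e_def hex_B_def by (rule hex_B_product)
  have Ce: "hex_C * e = 3 * dil e ^ 3" unfolding e_def by (rule hex_C_product)
  have dBe: "dil hex_B * dil (dil e) = dil e ^ 3"
    using arg_cong[OF Be, of dil] by (simp add: dil_mult dil_power)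
  have dCe: "dil hex_C * dil e = 3 * dil (dil e) ^ 3"
    using arg_cong[OF Ce, of dil] by (simp add: dil_mult dil_power)
  \<comment> \<open>Multiplying by a nonzero product of Euler series makes the product formulas
    applicable to all four theta series at once.\<close>
  have "(hex_B * hex_C ^ 3 - 9 * dil hex_C * dil hex_B ^ 3) * (dil e * e ^ 3 * dil (dil e) ^ 3)
    = (hex_B * dil e) * (hex_C * e) ^ 3 * dil (dil e) ^ 3 - 9 * (dil hex_C * dil e) * (dil
        hex_B * dil (dil e)) ^ 3 * e ^ 3"
    by algebra
  also have "\<dots> = 0"
    unfolding Be Ce dBe dCe by algebra
  finally have "hex_B * hex_C ^ 3 - 9 * dil hex_C * dil hex_B ^ 3 = 0"
    by (simp add: dil_eq_0_iff e_def fps_unit_nonzero)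
  then have BC: "hex_B * hex_C ^ 3 = 9 * dil hex_C * dil hex_B ^ 3" by simp
  have "dil D = x ^ 3 - dil hex_B ^ 3 - y ^ 3"
    by (simp add: D_def x_def y_def dil_diff dil_mult dil_power power_mult_distrib)
  then have "hex_B * D = fps_X * (9 * dil hex_C * dil D)"
    using BC unfolding D_def A B y_def by algebra
  then have "D = 0"
    by (rule dil_fixpoint_zero) (simp add: hex_B_def dil_nth)
  then show ?thesis
    by (simp add: D_def hex_C_eq_3Y power_mult_distrib algebra_simps)
qed

section \<open>Parametrization by \<open>hex_w\<close>\<close>

definition hex_A_inv :: "int fps" where
  "hex_A_inv = fps_right_inverse hex_A 1"

lemma hex_A_inv: "hex_A * hex_A_inv = 1"
  unfolding hex_A_inv_def by (rule fps_right_inverse) simp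

definition hex_v :: "int fps" where
  "hex_v = hex_Y * hex_A_inv"

text \<open>
  \<open>hex_w\<close> is the cube root of \<open>dil hex_tau\<close> with exponents 1 modulo 3,
      so trisecting a
  polynomial in \<open>hex_w\<close> means sorting its monomials by degree modulo 3.
\<close>

definition hex_w :: "int fps" where
  "hex_w = fps_X * dil hex_v"

definition hex_tau :: "int fps" where
  "hex_tau = fps_X * hex_v ^ 3"

lemma dil_hex_tau: "dil hex_tau = hex_w ^ 3"
  by (simp add: hex_tau_def hex_w_def dil_mult dil_power power_mult_distrib)

lemmas dil_simps = dil_add dil_diff dil_mult dil_power dil_hex_tau power_mult[symmetric]

lemma hex_w_times: "dil hex_A * hex_w = fps_X * dil hex_Y"
proof -
  have "hex_A * hex_v = hex_Y"
    using hex_A_inv unfolding hex_v_def by algebra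
  then have "dil hex_A * dil hex_v = dil hex_Y" by (metis dil_mult)
  then show ?thesis unfolding hex_w_def by (metis mult.left_commute)
qed

lemma hex_y_eq: "fps_X * dil hex_C = 3 * (dil hex_A * hex_w)"
  unfolding hex_w_times by (simp add: hex_C_eq_3Y dil_mult)

lemma hex_A_w: "hex_A = dil hex_A * (1 + 6 * hex_w)"
  using hex_A_eq unfolding hex_y_eq by algebra

lemma hex_B_w: "hex_B = dil hex_A * (1 - 3 * hex_w)"
  unfolding hex_B_def hex_y_eq by algebra

lemma dil_hex_A_nonzero: "dil hex_A \<noteq> (0 :: int fps)"
  by (simp add: dil_eq_0_iff fps_unit_nonzero)

text \<open>The cubic identity combined with
  \<open>(1 + 6 w) ^ 3 - (1 - 3 w) ^ 3 = 27 w (1 + 3 w + 9 w ^ 2)\<close>.\<close>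

lemma hex_Y_cube: "fps_X * hex_Y ^ 3 = dil hex_A ^ 3 * (hex_w * (1 + 3 * hex_w + 9 * hex_w ^ 2))"
proof -
  have "27 * (fps_X * hex_Y ^ 3) = hex_A ^ 3 - hex_B ^ 3"
    using hex_cubic_identity by algebra
  also have "hex_A ^ 3 = dil hex_A ^ 3 * (1 + 6 * hex_w) ^ 3"
    by (subst hex_A_w) (rule power_mult_distrib)
  also have "hex_B ^ 3 = dil hex_A ^ 3 * (1 - 3 * hex_w) ^ 3"
    by (subst hex_B_w) (rule power_mult_distrib)
  finally have "27 * (fps_X * hex_Y ^ 3) = 27 * (dil hex_A ^ 3 * (hex_w * (1 + 3 * hex_w +
      9 * hex_w ^ 2)))"
    by algebra
  then show ?thesis by simp
qed

lemma hex_tau_eq: "(1 + 6 * hex_w) ^ 3 * hex_tau = hex_w * (1 + 3 * hex_w + 9 * hex_w ^ 2)"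
proof -
  have "hex_A ^ 3 * hex_tau = fps_X * hex_Y ^ 3"
    using hex_A_inv unfolding hex_tau_def hex_v_def by algebra
  also have "hex_A ^ 3 = dil hex_A ^ 3 * (1 + 6 * hex_w) ^ 3"
    by (subst hex_A_w) (rule power_mult_distrib)
  finally have "dil hex_A ^ 3 * ((1 + 6 * hex_w) ^ 3 * hex_tau)
      = dil hex_A ^ 3 * (hex_w * (1 + 3 * hex_w + 9 * hex_w ^ 2))"
    by (simp only: hex_Y_cube mult.assoc)
  then show ?thesis using dil_hex_A_nonzero by simp
qed

lemma dil_partition_gf: "dil partition_gf = partition_gf ^ 3 * hex_B"
proof -
  have "euler * partition_gf = (1 :: int fps)" "dil euler * dil partition_gf = (1 :: int fps)"
    by (metis euler_partition_gf dil_mult dil_1)+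
  moreover have "hex_B * dil euler = euler ^ 3"
    unfolding hex_B_def by (rule hex_B_product)
  ultimately show ?thesis by algebra
qed

lemma hex_Y_partition_gf: "hex_Y * dil partition_gf ^ 3 = (partition_gf :: int fps)"
proof -
  have "euler * partition_gf = (1 :: int fps)" "dil euler * dil partition_gf = (1 :: int fps)"
    by (metis euler_partition_gf dil_mult dil_1)+
  then show ?thesis using hex_Y_euler by algebra
qed

text \<open>With \<open>x = dil hex_A\<close>, the theta series is \<open>x ^ 4\<close> times a
  polynomial in \<open>hex_w\<close>, while the cube of \<open>dil partition_gf\<close> is
  \<open>partition_gf ^ 9\<close> times \<open>x ^ 3 (1 - 3 w) ^ 3\<close>. One factor
  \<open>x\<close> survives in the prefactor.\<close>

lemma cphi_9_closed_form:
  "(1 - 3 * hex_w) ^ 3 * Abs_fps (\<lambda>n. int (cphi 9 n)) = dil (partition_gf ^ 3 * hex_A)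
    * ((1 + 6 * hex_w) ^ 3 + 54 * hex_w * (1 + 9 * hex_w) * (1 + 3 * hex_w + 9 * hex_w ^ 2))"
proof -
  define x w N f g where "x = (dil hex_A :: int fps)" and "w = hex_w" and "N = 1 + 3 * hex_w +
      9 * hex_w ^ 2"
    and "f = (partition_gf :: int fps)" and "g = dil (partition_gf :: int fps)"
  have "hex_A ^ 3 * dil hex_A + 2 * fps_X ^ 2 * hex_C ^ 3 * dil hex_C +
      6 * fps_X * hex_A * hex_C ^ 2 * hex_Y
    = hex_A ^ 3 * x + 54 * (fps_X * hex_Y ^ 3) * (fps_X * dil hex_C) + 54 * hex_A * (fps_X * hex_Y ^ 3)"
    unfolding hex_C_eq_3Y x_def dil_mult dil_numeral by algebra
  also have "\<dots> = (x * (1 + 6 * w)) ^ 3 * x + 54 * (x ^ 3 * (w * N)) * (3 * (x * w)) +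
      54 * (x * (1 + 6 * w)) * (x ^ 3 * (w * N))"
    unfolding hex_Y_cube hex_y_eq x_def w_def N_def hex_A_w[symmetric] ..
  also have "\<dots> = x ^ 4 * ((1 + 6 * w) ^ 3 + 54 * w * (1 + 9 * w) * N)"
    by algebra
  finally have series: "Abs_fps (\<lambda>n. int (cphi 9 n)) = f ^ 9 * (x ^ 4 * ((1 + 6 * w) ^ 3 +
      54 * w * (1 + 9 * w) * N))"
    unfolding cphi_9_series f_def by simp
  have g: "g = f ^ 3 * (x * (1 - 3 * w))"
    unfolding g_def f_def x_def w_def dil_partition_gf hex_B_w[symmetric] ..
  show ?thesis
    unfolding series dil_mult dil_power
    unfolding x_def[symmetric] w_def[symmetric] N_def[symmetric, folded w_def] g_def[symmetric]
    using g by algebra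
qed

section \<open>From polynomial certificates to trisected congruences\<close>

lemma congr_from_multiple:
  fixes F G u :: "int fps"
  assumes "u * F - u * G = d * H" "u $ 0 = 1"
  shows "congr d F G"
proof -
  obtain v where "u * v = 1" using fps_unit_exists[OF assms(2)] .
  moreover have "congr d (u * F) (u * G)"
    unfolding congr_def assms(1) by simp
  ultimately show ?thesis by (rule congr_unit_cancel)
qed

lemma hex_w_0 [simp]: "hex_w $ 0 = 0"
  by (simp add: hex_w_def)

lemma congr_initial:
  assumes "(1 + 6 * hex_w) ^ 3 + 54 * hex_w * (1 + 9 * hex_w) * (1 + 3 * hex_w + 9 * hex_w ^ 2)
    - (1 - 3 * hex_w) ^ 3 * Q = d * R"
  shows "congr d (Abs_fps (\<lambda>n. int (cphi 9 n))) (dil (partition_gf ^ 3 * hex_A) * Q)"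
proof (rule congr_from_multiple)
  show "(1 - 3 * hex_w) ^ 3 * Abs_fps (\<lambda>n. int (cphi 9 n)) - (1 - 3 * hex_w) ^ 3 * (dil
      (partition_gf ^ 3 * hex_A) * Q)
      = d * (dil (partition_gf ^ 3 * hex_A) * R)"
    unfolding cphi_9_closed_form using assms by algebra
  show "(1 - 3 * hex_w) ^ 3 $ 0 = 1" by (simp add: fps_power_zeroth)
qed

text \<open>Rests on \<open>(1 - 3 w) A f ^ 3 = f (q ^ 3) (1 + 6 w)\<close>; the denominators have
  constant term 1 and are therefore cancellable modulo \<open>d\<close>.\<close>

lemma congr_form_A:
  assumes "((1 + 6 * hex_w) ^ 3) ^ k * ((1 + 6 * hex_w) * S) - (1 - 3 * hex_w) * ((1 +
      6 * hex_w) ^ 3) ^ k * Q = d * R"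
  shows "congr d (hex_A * partition_gf ^ 3 * S) (dil partition_gf * Q)"
proof (rule congr_from_multiple)
  define u where "u = ((1 + 6 * hex_w) ^ 3) ^ k"
  have "(1 - 3 * hex_w) * (hex_A * partition_gf ^ 3) = dil partition_gf * (1 + 6 * hex_w)"
    using dil_partition_gf hex_A_w hex_B_w by algebra
  then show "((1 - 3 * hex_w) * u) * (hex_A * partition_gf ^ 3 * S) - ((1 - 3 * hex_w) * u) * (dil
      partition_gf * Q)
      = d * (dil partition_gf * R)"
    using assms[folded u_def] by algebra
  show "((1 - 3 * hex_w) * u) $ 0 = 1" by (simp add: fps_power_zeroth u_def)
qed

text \<open>Here only \<open>A\<close> has to be rewritten, as \<open>A (q ^ 3) (1 + 6 w)\<close>;
  the rest of the prefactor is already dilated.\<close>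

lemma congr_form_B:
  assumes "((1 + 6 * hex_w) ^ 3) ^ k * ((1 + 6 * hex_w) * S) - ((1 + 6 * hex_w) ^ 3) ^ k * Q = d * R"
  shows "congr d (hex_A * dil partition_gf ^ 3 * S) (dil (partition_gf ^ 3 * hex_A) * Q)"
proof (rule congr_from_multiple)
  define u where "u = ((1 + 6 * hex_w) ^ 3) ^ k"
  show "u * (hex_A * dil partition_gf ^ 3 * S) - u * (dil (partition_gf ^ 3 * hex_A) * Q)
      = d * (dil (partition_gf ^ 3 * hex_A) * R)"
    using assms[folded u_def] hex_A_w unfolding dil_mult dil_power by algebra
  show "u $ 0 = 1" by (simp add: fps_power_zeroth u_def)
qed

text \<open>As \<open>w ^ r\<close> is \<open>q ^ r\<close> times the dilation of
  \<open>v ^ r\<close>, class \<open>r\<close> retains exactly one summand and acquires the factor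
  \<open>v ^ r\<close>.\<close>

lemma sect_cubic:
  fixes G :: "int fps"
  shows "sect 0 (dil G * (dil p0 + hex_w * dil p1 + hex_w ^ 2 * dil p2)) = G * p0"
    and "sect 1 (dil G * (dil p0 + hex_w * dil p1 + hex_w ^ 2 * dil p2)) = G * hex_v * p1"
    and "sect 2 (dil G * (dil p0 + hex_w * dil p1 + hex_w ^ 2 * dil p2)) = G * hex_v ^ 2 * p2"
proof -
  have "dil p0 + hex_w * dil p1 + hex_w ^ 2 * dil p2
      = dil p0 * fps_X ^ 0 + dil (hex_v * p1) * fps_X ^ 1 + dil (hex_v ^ 2 * p2) * fps_X ^ 2"
    by (simp add: hex_w_def dil_mult dil_power power_mult_distrib mult_ac)
  then have *: "sect r (dil G * (dil p0 + hex_w * dil p1 + hex_w ^ 2 * dil p2))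
      = G * (p0 * sect r (fps_X ^ 0) + hex_v * p1 * sect r (fps_X ^ 1) + hex_v ^ 2 * p2 * sect
          r (fps_X ^ 2))"
    if "r < 3" for r
    using that by (simp only: sect_dil_mult sect_add)
  have X: "sect r (fps_X ^ s :: int fps) = (if r = s then 1 else 0)" if "r < 3" "s < 3" for r s
    by (rule sect_X_power) (use that in auto)
  have X0: "sect 0 (fps_X ^ 0 :: int fps) = 1" "sect 0 (fps_X ^ 1 :: int fps) = 0" "sect 0
      (fps_X ^ 2 :: int fps) = 0"
    by (subst X; simp)+
  have X1: "sect 1 (fps_X ^ 0 :: int fps) = 0" "sect 1 (fps_X ^ 1 :: int fps) = 1" "sect 1
      (fps_X ^ 2 :: int fps) = 0"
    by (subst X; simp)+
  have X2: "sect 2 (fps_X ^ 0 :: int fps) = 0" "sect 2 (fps_X ^ 1 :: int fps) = 0" "sect 2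
      (fps_X ^ 2 :: int fps) = 1"
    by (subst X; simp)+
  show "sect 0 (dil G * (dil p0 + hex_w * dil p1 + hex_w ^ 2 * dil p2)) = G * p0"
    by (subst *, simp) (simp only: X0, simp)
  show "sect 1 (dil G * (dil p0 + hex_w * dil p1 + hex_w ^ 2 * dil p2)) = G * hex_v * p1"
    by (subst *, simp) (simp only: X1, simp)
  show "sect 2 (dil G * (dil p0 + hex_w * dil p1 + hex_w ^ 2 * dil p2)) = G * hex_v ^ 2 * p2"
    by (subst *, simp) (simp only: X2, simp)
qed

text \<open>Returns class 2 to the standard form: \<open>f = Y f (q ^ 3) ^ 3\<close> and
  \<open>Y = A v\<close>, so the two factors \<open>v\<close> become three and combine with
  \<open>q\<close> into \<open>\<tau>\<close>.\<close>

lemma X_partition_gf_v: "fps_X * (partition_gf * hex_v ^ 2) = hex_A * dil partition_gf ^ 3 * hex_tau"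
proof -
  have "hex_A * dil partition_gf ^ 3 * hex_tau
      = (hex_A * hex_A_inv) * (hex_Y * dil partition_gf ^ 3) * (fps_X * hex_v ^ 2)"
    by (simp add: hex_tau_def hex_v_def power2_eq_square power3_eq_cube mult_ac)
  then show ?thesis
    by (simp add: hex_A_inv hex_Y_partition_gf mult_ac)
qed

lemma sect_congr:
  assumes "congr (3 ^ k) F (G :: int fps)" "r < 3"
  shows "congr (3 ^ k) (sect r F) (sect r G)"
proof -
  obtain H where "F - G = 3 ^ k * H" using assms(1) by (auto simp: congr_def dvd_def)
  then have "sect r F - sect r G = sect r (dil (3 ^ k) * H)"
    by (simp add: sect_diff[symmetric] dil_power)
  also have "\<dots> = 3 ^ k * sect r H" by (rule sect_dil_mult) fact
  finally show ?thesis unfolding congr_def by simp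
qed

lemma congr_nth_dvd:
  assumes "congr (3 ^ k) F (3 ^ e * G :: int fps)" "e \<le> k"
  shows "3 ^ e dvd F $ n"
proof -
  obtain H where "F - 3 ^ e * G = 3 ^ k * H" using assms(1) by (auto simp: congr_def dvd_def)
  then have "F = 3 ^ e * (G + 3 ^ (k - e) * H)"
    using assms(2) by (simp add: algebra_simps flip: power_add)
  also have "\<dots> = fps_const (3 ^ e) * (G + 3 ^ (k - e) * H)"
    by (simp add: numeral_fps_const fps_const_power)
  finally have "F $ n = 3 ^ e * (G + 3 ^ (k - e) * H) $ n" by simp
  then show ?thesis by simp
qed

subsection \<open>The chain of congruences\<close>

lemma cphi_9_congr:
  "congr (3 ^ 14) (Abs_fps (\<lambda>n. int (cphi 9 n)))
    (dil (partition_gf ^ 3 * hex_A) * (dil (1 + 13122 * hex_tau + 2125764 * hex_tau ^ 2) +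
        hex_w * dil (3 ^ 4 * (1 + 1053 * hex_tau - 4374 * hex_tau ^ 2))
      + hex_w ^ 2 * dil (3 ^ 6 * (2 + 621 * hex_tau - 729 * hex_tau ^ 2))))"
  using congr_initial[OF certificate_init[of hex_w]]
  by (simp add: dil_simps)

lemma congr_step_1:
  "congr (3 ^ 14) (hex_A * partition_gf ^ 3 * (1 + 13122 * hex_tau + 2125764 * hex_tau ^ 2))
    (dil partition_gf * (dil ((1 - 767556 * hex_tau - 1592136 * hex_tau ^ 2 +
        59049 * hex_tau ^ 3 + 1594323 * hex_tau ^ 4)) + hex_w * dil (3 ^ 2 * (1459 -
        137754 * hex_tau + 729 * hex_tau ^ 2 + 19683 * hex_tau ^ 3))
      + hex_w ^ 2 * dil (3 ^ 3 * (75817 - 78705 * hex_tau + 729 * hex_tau ^ 2 + 19683 * hex_tau ^ 3))))"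
  using congr_form_A[OF certificate_1[OF hex_tau_eq refl refl]]
  by (simp add: dil_simps)

lemma congr_step_2:
  "congr (3 ^ 14) (hex_A * dil partition_gf ^ 3 * (2047059 * hex_tau - 2125035 * hex_tau ^ 2 +
      19683 * hex_tau ^ 3 + 531441 * hex_tau ^ 4))
    (dil (partition_gf ^ 3 * hex_A) * (dil (3 ^ 7 * (731 * hex_tau + 324 * hex_tau ^ 2 +
        729 * hex_tau ^ 3)) + hex_w * dil (3 ^ 3 * (75817 - 57996 * hex_tau - 63423 * hex_tau ^ 2 +
        59049 * hex_tau ^ 3))
      + hex_w ^ 2 * dil (3 ^ 5 * (- (5830) + 621 * hex_tau - 7290 * hex_tau ^ 2))))"
  using congr_form_B[OF certificate_2[OF hex_tau_eq refl refl]]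
  by (simp add: dil_simps)

lemma congr_step_3:
  "congr (3 ^ 14) (hex_A * partition_gf ^ 3 * (1598697 * hex_tau + 708588 * hex_tau ^ 2 +
      1594323 * hex_tau ^ 3))
    (dil partition_gf * (dil (3 ^ 9 * (68 * hex_tau - 108 * hex_tau ^ 2)) + hex_w * dil
        (3 ^ 7 * (731 - 918 * hex_tau - 729 * hex_tau ^ 2))
      + hex_w ^ 2 * dil (3 ^ 8 * (104 + 135 * hex_tau))))"
  using congr_form_A[OF certificate_3[OF hex_tau_eq refl refl]]
  by (simp add: dil_simps)

lemma congr_step_4:
  "congr (3 ^ 14) (hex_A * dil partition_gf ^ 3 * (682344 * hex_tau + 885735 * hex_tau ^ 2))
    (dil (partition_gf ^ 3 * hex_A) * (dil (3 ^ 12 * (hex_tau)) + hex_w * dil (3 ^ 8 * (104 +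
        162 * hex_tau))
      + hex_w ^ 2 * dil (3 ^ 10 * (- (8) + 27 * hex_tau))))"
  using congr_form_B[OF certificate_4[OF hex_tau_eq refl refl]]
  by (simp add: dil_simps)

lemma congr_step_5:
  "congr (3 ^ 14) (hex_A * partition_gf ^ 3 * (531441 * hex_tau))
    (dil partition_gf * (dil (0) + hex_w * dil (3 ^ 12 * (1))
      + hex_w ^ 2 * dil (3 ^ 13 * (1))))"
  using congr_form_A[OF certificate_5[OF hex_tau_eq refl refl]]
  by (simp add: dil_simps)

text \<open>The five series follow the arguments \<open>3 m\<close>, \<open>9 m + 6\<close>,
  \<open>27 m + 24\<close>, \<open>81 m + 51\<close>, \<open>243 m + 213\<close>. From
  \<open>frob2\<close> on the coefficient for \<open>m\<close> has index \<open>Suc m\<close>, an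
  effect of the factor \<open>fps_X\<close>.\<close>

definition frob1 :: "int fps" where "frob1 = sect 0 (Abs_fps (\<lambda>n. int (cphi 9 n)))"
definition frob2 :: "int fps" where "frob2 = fps_X * sect 2 frob1"
definition frob3 :: "int fps" where "frob3 = sect 0 frob2"
definition frob4 :: "int fps" where "frob4 = fps_X * sect 2 frob3"
definition frob5 :: "int fps" where "frob5 = sect 0 frob4"

lemma frob1_congr: "congr (3 ^ 14) frob1 (hex_A * partition_gf ^ 3 * (1 + 13122 * hex_tau +
    2125764 * hex_tau ^ 2))"
  using sect_congr[OF cphi_9_congr, of 0] unfolding sect_cubic frob1_def by (simp add: mult_ac)

lemma frob2_congr: "congr (3 ^ 14) frob2 (hex_A * dil partition_gf ^ 3 * (2047059 * hex_tau -
    2125035 * hex_tau ^ 2 + 19683 * hex_tau ^ 3 + 531441 * hex_tau ^ 4))"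
proof -
  have "congr (3 ^ 14) (sect 2 frob1) (partition_gf * hex_v ^ 2 * (3 ^ 3 * (75817 -
      78705 * hex_tau + 729 * hex_tau ^ 2 + 19683 * hex_tau ^ 3)))"
    using sect_congr[OF congr_trans[OF frob1_congr congr_step_1], of 2] unfolding sect_cubic by simp
  then have "congr (3 ^ 14) frob2 (fps_X * (partition_gf * hex_v ^ 2) * (3 ^ 3 * (75817 -
      78705 * hex_tau + 729 * hex_tau ^ 2 + 19683 * hex_tau ^ 3)))"
    unfolding frob2_def mult.assoc by (rule congr_mult_left)
  then show ?thesis
    unfolding X_partition_gf_v by (simp add: algebra_simps power2_eq_square power3_eq_cube
        power4_eq_xxxx)
qed

lemma frob3_congr: "congr (3 ^ 14) frob3 (hex_A * partition_gf ^ 3 * (1598697 * hex_tau +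
    708588 * hex_tau ^ 2 + 1594323 * hex_tau ^ 3))"
  using sect_congr[OF congr_trans[OF frob2_congr congr_step_2], of 0] unfolding sect_cubic frob3_def
  by (simp add: algebra_simps)

lemma frob4_congr: "congr (3 ^ 14) frob4 (hex_A * dil partition_gf ^ 3 * (682344 * hex_tau +
    885735 * hex_tau ^ 2))"
proof -
  have "congr (3 ^ 14) (sect 2 frob3) (partition_gf * hex_v ^ 2 * (3 ^ 8 * (104 + 135 * hex_tau)))"
    using sect_congr[OF congr_trans[OF frob3_congr congr_step_3], of 2] unfolding sect_cubic by simp
  then have "congr (3 ^ 14) frob4 (fps_X * (partition_gf * hex_v ^ 2) * (3 ^ 8 * (104 + 135 * hex_tau)))"
    unfolding frob4_def mult.assoc by (rule congr_mult_left)
  then show ?thesis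
    unfolding X_partition_gf_v by (simp add: algebra_simps power2_eq_square)
qed

lemma frob5_congr: "congr (3 ^ 14) frob5 (hex_A * partition_gf ^ 3 * (531441 * hex_tau))"
  using sect_congr[OF congr_trans[OF frob4_congr congr_step_4], of 0] unfolding sect_cubic frob5_def
  by (simp add: algebra_simps)

lemma frob_nth:
  "frob1 $ m = int (cphi 9 (3 * m))"
  "frob2 $ Suc m = int (cphi 9 (9 * m + 6))"
  "frob3 $ Suc m = int (cphi 9 (27 * m + 24))"
  "frob4 $ Suc m = int (cphi 9 (81 * m + 51))"
  "frob5 $ Suc m = int (cphi 9 (243 * m + 213))"
proof -
  show 1: "frob1 $ m = int (cphi 9 (3 * m))" for m
    by (simp add: frob1_def sect_def)
  have s2: "frob2 $ Suc m = frob1 $ (3 * m + 2)" for m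
    by (simp add: frob2_def sect_def)
  show 2: "frob2 $ Suc m = int (cphi 9 (9 * m + 6))" for m
    unfolding s2 1 by (simp add: algebra_simps)
  have s3: "frob3 $ Suc m = frob2 $ Suc (3 * m + 2)" for m
    unfolding frob3_def sect_def fps_nth_Abs_fps by (rule arg_cong[where f = "fps_nth frob2"]) simp
  show 3: "frob3 $ Suc m = int (cphi 9 (27 * m + 24))" for m
    unfolding s3 2 by (simp add: algebra_simps)
  have s4: "frob4 $ Suc m = frob3 $ Suc (3 * m + 1)" for m
    by (simp add: frob4_def sect_def)
  show 4: "frob4 $ Suc m = int (cphi 9 (81 * m + 51))" for m
    unfolding s4 3 by (simp add: algebra_simps)
  have s5: "frob5 $ Suc m = frob4 $ Suc (3 * m + 2)" for m
    unfolding frob5_def sect_def fps_nth_Abs_fps by (rule arg_cong[where f = "fps_nth frob4"]) simp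
  show "frob5 $ Suc m = int (cphi 9 (243 * m + 213))"
    unfolding s5 4 by (simp add: algebra_simps)
qed

lemma sect_dvd:
  assumes "congr (3 ^ 14) F (dil G * (dil p0 + hex_w * dil p1 + hex_w ^ 2 * dil p2))"
  shows "p0 = 3 ^ e * q \<Longrightarrow> e \<le> 14 \<Longrightarrow> 3 ^ e dvd F $ (3 * m)"
    and "p1 = 3 ^ e * q \<Longrightarrow> e \<le> 14 \<Longrightarrow> 3 ^ e dvd F $ (3 * m + 1)"
    and "p2 = 3 ^ e * q \<Longrightarrow> e \<le> 14 \<Longrightarrow> 3 ^ e dvd F $ (3 * m + 2)"
proof -
  have s: "F $ (3 * m) = sect 0 F $ m" "F $ (3 * m + 1) = sect 1 F $ m" "F $ (3 * m + 2) = sect 2 F $ m"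
    by (simp_all add: sect_def)
  show "3 ^ e dvd F $ (3 * m)" if "p0 = 3 ^ e * q" "e \<le> 14"
  proof -
    have "congr (3 ^ 14) (sect 0 F) (3 ^ e * (G * q))"
      using sect_congr[OF assms, of 0] unfolding sect_cubic that(1) mult.left_commute[of G] by simp
    then show ?thesis unfolding s using that(2) by (rule congr_nth_dvd)
  qed
  show "3 ^ e dvd F $ (3 * m + 1)" if "p1 = 3 ^ e * q" "e \<le> 14"
  proof -
    have "congr (3 ^ 14) (sect 1 F) (3 ^ e * (G * hex_v * q))"
      using sect_congr[OF assms, of 1] unfolding sect_cubic that(1) mult.left_commute[of
          "G * hex_v"] by simp
    then show ?thesis unfolding s using that(2) by (rule congr_nth_dvd)
  qed
  show "3 ^ e dvd F $ (3 * m + 2)" if "p2 = 3 ^ e * q" "e \<le> 14"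
  proof -
    have "congr (3 ^ 14) (sect 2 F) (3 ^ e * (G * hex_v ^ 2 * q))"
      using sect_congr[OF assms, of 2] unfolding sect_cubic that(1) mult.left_commute[of
          "G * hex_v ^ 2"] by simp
    then show ?thesis unfolding s using that(2) by (rule congr_nth_dvd)
  qed
qed

lemma cong_0_of_int_dvd: "3 ^ e dvd int c \<Longrightarrow> [c = 0] (mod 3 ^ e)"
  by (metis cong_0_iff int_dvd_int_iff of_nat_numeral of_nat_power)

theorem theorem1p3:
  fixes n :: nat
  shows "[cphi 9 (9 * n + 3) = 0] (mod 3 ^ 2) \<and>
    [cphi 9 (9 * n + 6) = 0] (mod 3 ^ 3) \<and>
    [cphi 9 (27 * n + 15) = 0] (mod 3 ^ 5) \<and>
    [cphi 9 (27 * n + 24) = 0] (mod 3 ^ 7) \<and>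
    [cphi 9 (81 * n + 51) = 0] (mod 3 ^ 8) \<and>
    [cphi 9 (81 * n + 78) = 0] (mod 3 ^ 9) \<and>
    [cphi 9 (243 * n + 132) = 0] (mod 3 ^ 10) \<and>
    [cphi 9 (243 * n + 213) = 0] (mod 3 ^ 12) \<and>
    [cphi 9 (729 * n + 456) = 0] (mod 3 ^ 13) \<and>
    [cphi 9 (729 * n + 699) = 0] (mod 3 ^ 14)"
proof -
  \<comment> \<open>Owing to that shift, class 0 is read at \<open>Suc n\<close>, that is at index
    \<open>3 * n + 3\<close>, and class 2 at \<open>3 * n + 2\<close>.\<close>
  have idx: "3 * Suc n = Suc (3 * n + 2)" "3 * n + 2 = Suc (3 * n + 1)" by simp_all
  note frob1 = congr_trans[OF frob1_congr congr_step_1]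
  note frob2 = congr_trans[OF frob2_congr congr_step_2]
  note frob3 = congr_trans[OF frob3_congr congr_step_3]
  note frob4 = congr_trans[OF frob4_congr congr_step_4]
  note frob5 = congr_trans[OF frob5_congr congr_step_5]
  have "3 ^ 2 dvd frob1 $ (3 * n + 1)" by (rule sect_dvd(2)[OF frob1 refl]) simp
  moreover have "3 ^ 3 dvd frob1 $ (3 * n + 2)" by (rule sect_dvd(3)[OF frob1 refl]) simp
  moreover have "3 ^ 5 dvd frob2 $ Suc (3 * n + 1)" by (rule sect_dvd(3)[OF frob2 refl, of n,
      unfolded idx(2)]) simp
  moreover have "3 ^ 7 dvd frob2 $ Suc (3 * n + 2)" by (rule sect_dvd(1)[OF frob2 refl, of "Suc
      n", unfolded idx(1)]) simp
  moreover have "3 ^ 8 dvd frob3 $ Suc (3 * n + 1)" by (rule sect_dvd(3)[OF frob3 refl, of n,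
      unfolded idx(2)]) simp
  moreover have "3 ^ 9 dvd frob3 $ Suc (3 * n + 2)" by (rule sect_dvd(1)[OF frob3 refl, of "Suc
      n", unfolded idx(1)]) simp
  moreover have "3 ^ 10 dvd frob4 $ Suc (3 * n + 1)" by (rule sect_dvd(3)[OF frob4 refl, of n,
      unfolded idx(2)]) simp
  moreover have "3 ^ 12 dvd frob4 $ Suc (3 * n + 2)" by (rule sect_dvd(1)[OF frob4 refl, of "Suc
      n", unfolded idx(1)]) simp
  moreover have "3 ^ 13 dvd frob5 $ Suc (3 * n + 1)" by (rule sect_dvd(3)[OF frob5 refl, of n,
      unfolded idx(2)]) simp
  \<comment> \<open>Class 0 is zero in \<open>congr_step_5\<close>, so the exponent 14 and the
    cofactor 0 are supplied by hand.\<close>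
  moreover have "3 ^ 14 dvd frob5 $ Suc (3 * n + 2)"
    by (rule sect_dvd(1)[OF frob5, of 14 0 "Suc n", unfolded idx(1)]) simp_all
  ultimately show ?thesis
    unfolding frob_nth by (intro conjI cong_0_of_int_dvd) (simp_all add: algebra_simps)
qed

end
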